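(* Let $\mathbb{C}$ be an exact category satisfying Condition P. If $\mathbb{C}$ has finite colimits, then $\mathbb{C}$ is coexact.
   Context: A category is regular if it is finitely complete, admits coequalizers of kernel pairs, and its regular epimorphisms are pullback stable. A regular category is exact (in the sense of Barr) if every internal equivalence relation in it is effective, i.e. is the kernel pair of some morphism. A category is coexact if its opposite category is exact. A feeble pullback in a category with finite limits is a commutative square such that the unique induced morphism from its initial corner into the pullback is a regular epimorphism. A category $\mathbb{C}$ with finite limits is said to satisfy Condition P if: (a) finite coproducts exist in $\mathbb{C}$; (b) binary coproducts of pullback squares are pullback squares in $\mathbb{C}$ (that is, given two pullback squares, the square obtained by taking the binary coproduct of corresponding objects and morphisms is a pullback); (c) for each monomorphism $m:S\to A$ in $\mathbb{C}$, the commutative square with top $m+1_S:S+S\to A+S$, left side $[1_S,1_S]:S+S\to S$, right side $[1_A,m]:A+S\to A$ and bottom $m:S\to A$ is a pullback; (d) for each regular epimorphism $p:E\to B$ in $\mathbb{C}$, the commutative square with top $p+p:E+E\to B+B$, left side $[1_E,1_E]:E+E\to E$, right side $[1_B,1_B]:B+B\to B$ and bottom $p:E\to B$ is a feeble pullback. *)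

theory Defs
  imports Main
begin

section \<open>Categories\<close>

text \<open>
  A category is given by carrier sets of objects and arrows inside arbitrary types. The
  composite \<open>g \<cdot> f\<close> (first \<open>f\<close>, then \<open>g\<close>) is meaningful only when
  \<open>cod f = dom g\<close>; nothing is assumed about it otherwise.
\<close>

record ('o, 'a) cat =
  Obj :: "'o set"
  Arr :: "'a set"
  dom :: "'a \<Rightarrow> 'o"
  cod :: "'a \<Rightarrow> 'o"
  ident :: "'o \<Rightarrow> 'a"
  comp :: "'a \<Rightarrow> 'a \<Rightarrow> 'a" (infixl "\<cdot>\<index>" 70)

definition Hom :: "('o, 'a) cat \<Rightarrow> 'o \<Rightarrow> 'o \<Rightarrow> 'a set" where
  "Hom C a b = {f \<in> Arr C. dom C f = a \<and> cod C f = b}"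

locale category =
  fixes C :: "('o, 'a) cat" (structure)
  assumes dom_closed: "f \<in> Arr C \<Longrightarrow> dom C f \<in> Obj C"
    and cod_closed: "f \<in> Arr C \<Longrightarrow> cod C f \<in> Obj C"
    and ident_closed: "a \<in> Obj C \<Longrightarrow> ident C a \<in> Hom C a a"
    and comp_closed: "f \<in> Hom C a b \<Longrightarrow> g \<in> Hom C b c \<Longrightarrow> g \<cdot> f \<in> Hom C a c"
    and ident_right: "f \<in> Hom C a b \<Longrightarrow> f \<cdot> ident C a = f"
    and ident_left: "f \<in> Hom C a b \<Longrightarrow> ident C b \<cdot> f = f"
    and comp_assoc: "f \<in> Hom C a b \<Longrightarrow> g \<in> Hom C b c \<Longrightarrow> h \<in> Hom C c d \<Longrightarrow>
      h \<cdot> g \<cdot> f = h \<cdot> (g \<cdot> f)"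

definition op_cat :: "('o, 'a) cat \<Rightarrow> ('o, 'a) cat" where
  "op_cat C = \<lparr>Obj = Obj C, Arr = Arr C, dom = cod C, cod = dom C, ident = ident C,
    comp = (\<lambda>g f. f \<cdot>\<^bsub>C\<^esub> g)\<rparr>"

lemma Hom_op_cat: "Hom (op_cat C) a b = Hom C b a"
  by (auto simp: Hom_def op_cat_def)

lemma op_cat_op_cat: "op_cat (op_cat C) = C"
  by (simp add: op_cat_def)

lemma category_op_cat:
  assumes "category C"
  shows "category (op_cat C)"
proof -
  interpret category C by fact
  show ?thesis
  proof
    show "\<And>f. f \<in> Arr (op_cat C) \<Longrightarrow> dom (op_cat C) f \<in> Obj (op_cat C)"
      by (simp add: op_cat_def cod_closed)
    show "\<And>f. f \<in> Arr (op_cat C) \<Longrightarrow> cod (op_cat C) f \<in> Obj (op_cat C)"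
      by (simp add: op_cat_def dom_closed)
    show "\<And>a. a \<in> Obj (op_cat C) \<Longrightarrow> ident (op_cat C) a \<in> Hom (op_cat C) a a"
      unfolding Hom_op_cat by (simp add: op_cat_def ident_closed)
    show "\<And>f a b g c. f \<in> Hom (op_cat C) a b \<Longrightarrow> g \<in> Hom (op_cat C) b c \<Longrightarrow>
        g \<cdot>\<^bsub>op_cat C\<^esub> f \<in> Hom (op_cat C) a c"
      unfolding Hom_op_cat by (simp add: op_cat_def comp_closed)
    show "\<And>f a b. f \<in> Hom (op_cat C) a b \<Longrightarrow> f \<cdot>\<^bsub>op_cat C\<^esub> ident (op_cat C) a = f"
      unfolding Hom_op_cat by (simp add: op_cat_def ident_left)
    show "\<And>f a b. f \<in> Hom (op_cat C) a b \<Longrightarrow> ident (op_cat C) b \<cdot>\<^bsub>op_cat C\<^esub> f = f"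
      unfolding Hom_op_cat by (simp add: op_cat_def ident_right)
    show "\<And>f a b g c h d. f \<in> Hom (op_cat C) a b \<Longrightarrow> g \<in> Hom (op_cat C) b c \<Longrightarrow>
        h \<in> Hom (op_cat C) c d \<Longrightarrow>
        h \<cdot>\<^bsub>op_cat C\<^esub> g \<cdot>\<^bsub>op_cat C\<^esub> f = h \<cdot>\<^bsub>op_cat C\<^esub> (g \<cdot>\<^bsub>op_cat C\<^esub> f)"
      unfolding Hom_op_cat by (simp add: op_cat_def comp_assoc)
  qed
qed


section \<open>Finite limits and colimits\<close>

text \<open>A diagram of shape \<open>J\<close>: a functor with object part \<open>D\<close> and arrow part \<open>F\<close>.\<close>

definition is_functor ::
  "('i, 'j) cat \<Rightarrow> ('o, 'a) cat \<Rightarrow> ('i \<Rightarrow> 'o) \<Rightarrow> ('j \<Rightarrow> 'a) \<Rightarrow> bool" where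
  "is_functor J C D F \<longleftrightarrow>
     (\<forall>i \<in> Obj J. D i \<in> Obj C) \<and>
     (\<forall>f \<in> Arr J. F f \<in> Hom C (D (dom J f)) (D (cod J f))) \<and>
     (\<forall>i \<in> Obj J. F (ident J i) = ident C (D i)) \<and>
     (\<forall>f \<in> Arr J. \<forall>g \<in> Arr J. dom J g = cod J f \<longrightarrow> F (g \<cdot>\<^bsub>J\<^esub> f) = F g \<cdot>\<^bsub>C\<^esub> F f)"

definition is_cone ::
  "('i, 'j) cat \<Rightarrow> ('o, 'a) cat \<Rightarrow> ('i \<Rightarrow> 'o) \<Rightarrow> ('j \<Rightarrow> 'a) \<Rightarrow> 'o \<Rightarrow> ('i \<Rightarrow> 'a) \<Rightarrow> bool" where
  "is_cone J C D F L \<pi> \<longleftrightarrow>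
     L \<in> Obj C \<and>
     (\<forall>i \<in> Obj J. \<pi> i \<in> Hom C L (D i)) \<and>
     (\<forall>f \<in> Arr J. F f \<cdot>\<^bsub>C\<^esub> \<pi> (dom J f) = \<pi> (cod J f))"

definition is_limit ::
  "('i, 'j) cat \<Rightarrow> ('o, 'a) cat \<Rightarrow> ('i \<Rightarrow> 'o) \<Rightarrow> ('j \<Rightarrow> 'a) \<Rightarrow> 'o \<Rightarrow> ('i \<Rightarrow> 'a) \<Rightarrow> bool" where
  "is_limit J C D F L \<pi> \<longleftrightarrow>
     is_cone J C D F L \<pi> \<and>
     (\<forall>M \<sigma>. is_cone J C D F M \<sigma> \<longrightarrow>
        (\<exists>!h. h \<in> Hom C M L \<and> (\<forall>i \<in> Obj J. \<pi> i \<cdot>\<^bsub>C\<^esub> h = \<sigma> i)))"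

text \<open>
  Every finite category is isomorphic to one whose objects and arrows are natural numbers, so
  it is enough to let the shapes \<open>J\<close> range over finite categories of this kind.
\<close>

definition finitely_complete :: "('o, 'a) cat \<Rightarrow> bool" where
  "finitely_complete C \<longleftrightarrow>
     (\<forall>(J :: (nat, nat) cat) D F.
        category J \<and> finite (Obj J) \<and> finite (Arr J) \<and> is_functor J C D F \<longrightarrow>
        (\<exists>L \<pi>. is_limit J C D F L \<pi>))"

text \<open>
  A colimit of a functor \<open>J \<rightarrow> C\<close> is a limit of the corresponding functor
  \<open>op_cat J \<rightarrow> op_cat C\<close>, and finite shapes are closed under \<open>op_cat\<close>.
\<close>

definition finitely_cocomplete :: "('o, 'a) cat \<Rightarrow> bool" where
  "finitely_cocomplete C \<longleftrightarrow> finitely_complete (op_cat C)"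


section \<open>Monomorphisms, pullbacks and coequalizers\<close>

definition is_mono :: "('o, 'a) cat \<Rightarrow> 'a \<Rightarrow> bool" where
  "is_mono C m \<longleftrightarrow> m \<in> Arr C \<and>
     (\<forall>x g h. g \<in> Hom C x (dom C m) \<and> h \<in> Hom C x (dom C m) \<and> m \<cdot>\<^bsub>C\<^esub> g = m \<cdot>\<^bsub>C\<^esub> h \<longrightarrow> g = h)"

text \<open>
  The square with left side \<open>p\<close>, top \<open>q\<close>, bottom \<open>f\<close> and right side \<open>g\<close>,
  i.e. \<open>f \<cdot> p = g \<cdot> q\<close>.
\<close>

definition commutative_square :: "('o, 'a) cat \<Rightarrow> 'a \<Rightarrow> 'a \<Rightarrow> 'a \<Rightarrow> 'a \<Rightarrow> bool" where
  "commutative_square C f g p q \<longleftrightarrow>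
     f \<in> Arr C \<and> g \<in> Arr C \<and> cod C f = cod C g \<and>
     p \<in> Hom C (dom C p) (dom C f) \<and> q \<in> Hom C (dom C p) (dom C g) \<and>
     f \<cdot>\<^bsub>C\<^esub> p = g \<cdot>\<^bsub>C\<^esub> q"

definition is_pullback :: "('o, 'a) cat \<Rightarrow> 'a \<Rightarrow> 'a \<Rightarrow> 'a \<Rightarrow> 'a \<Rightarrow> bool" where
  "is_pullback C f g p q \<longleftrightarrow>
     commutative_square C f g p q \<and>
     (\<forall>u v. commutative_square C f g u v \<longrightarrow>
        (\<exists>!h. h \<in> Hom C (dom C u) (dom C p) \<and> p \<cdot>\<^bsub>C\<^esub> h = u \<and> q \<cdot>\<^bsub>C\<^esub> h = v))"

definition is_kernel_pair :: "('o, 'a) cat \<Rightarrow> 'a \<Rightarrow> 'a \<Rightarrow> 'a \<Rightarrow> bool" where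
  "is_kernel_pair C f u v \<longleftrightarrow> is_pullback C f f u v"

definition is_coequalizer :: "('o, 'a) cat \<Rightarrow> 'a \<Rightarrow> 'a \<Rightarrow> 'a \<Rightarrow> bool" where
  "is_coequalizer C u v q \<longleftrightarrow>
     u \<in> Arr C \<and> v \<in> Hom C (dom C u) (cod C u) \<and>
     q \<in> Hom C (cod C u) (cod C q) \<and> q \<cdot>\<^bsub>C\<^esub> u = q \<cdot>\<^bsub>C\<^esub> v \<and>
     (\<forall>x h. h \<in> Hom C (cod C u) x \<and> h \<cdot>\<^bsub>C\<^esub> u = h \<cdot>\<^bsub>C\<^esub> v \<longrightarrow>
        (\<exists>!k. k \<in> Hom C (cod C q) x \<and> k \<cdot>\<^bsub>C\<^esub> q = h))"

definition is_regular_epi :: "('o, 'a) cat \<Rightarrow> 'a \<Rightarrow> bool" where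
  "is_regular_epi C p \<longleftrightarrow> (\<exists>u v. is_coequalizer C u v p)"

text \<open>
  The comparison morphism into a pullback is a regular epimorphism for one choice of the
  pullback if and only if it is one for every choice.
\<close>

definition is_feeble_pullback :: "('o, 'a) cat \<Rightarrow> 'a \<Rightarrow> 'a \<Rightarrow> 'a \<Rightarrow> 'a \<Rightarrow> bool" where
  "is_feeble_pullback C f g u v \<longleftrightarrow>
     commutative_square C f g u v \<and>
     (\<exists>p q h. is_pullback C f g p q \<and>
        h \<in> Hom C (dom C u) (dom C p) \<and> p \<cdot>\<^bsub>C\<^esub> h = u \<and> q \<cdot>\<^bsub>C\<^esub> h = v \<and>
        is_regular_epi C h)"


section \<open>Regular, exact and coexact categories\<close>

definition regular_category :: "('o, 'a) cat \<Rightarrow> bool" where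
  "regular_category C \<longleftrightarrow>
     category C \<and> finitely_complete C \<and>
     (\<forall>f u v. is_kernel_pair C f u v \<longrightarrow> (\<exists>q. is_coequalizer C u v q)) \<and>
     (\<forall>f g p q. is_pullback C f g p q \<and> is_regular_epi C f \<longrightarrow> is_regular_epi C q)"

text \<open>
  An internal equivalence relation on \<open>X\<close>: a jointly monic pair \<open>d0, d1 : R \<rightarrow> X\<close> with
  morphisms \<open>r\<close>, \<open>s\<close>, \<open>t\<close> witnessing reflexivity, symmetry and transitivity,
  where \<open>t\<close> is defined on the pullback of \<open>d1\<close> along \<open>d0\<close>, that is, on the object of
  pairs \<open>((x, y), (y, z))\<close>.
\<close>

definition is_equivalence_relation :: "('o, 'a) cat \<Rightarrow> 'o \<Rightarrow> 'o \<Rightarrow> 'a \<Rightarrow> 'a \<Rightarrow> bool" where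
  "is_equivalence_relation C R X d0 d1 \<longleftrightarrow>
     d0 \<in> Hom C R X \<and> d1 \<in> Hom C R X \<and>
     (\<forall>x g h. g \<in> Hom C x R \<and> h \<in> Hom C x R \<and>
        d0 \<cdot>\<^bsub>C\<^esub> g = d0 \<cdot>\<^bsub>C\<^esub> h \<and> d1 \<cdot>\<^bsub>C\<^esub> g = d1 \<cdot>\<^bsub>C\<^esub> h \<longrightarrow> g = h) \<and>
     (\<exists>r \<in> Hom C X R. d0 \<cdot>\<^bsub>C\<^esub> r = ident C X \<and> d1 \<cdot>\<^bsub>C\<^esub> r = ident C X) \<and>
     (\<exists>s \<in> Hom C R R. d0 \<cdot>\<^bsub>C\<^esub> s = d1 \<and> d1 \<cdot>\<^bsub>C\<^esub> s = d0) \<and>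
     (\<exists>p q. is_pullback C d1 d0 p q \<and>
        (\<exists>t \<in> Hom C (dom C p) R. d0 \<cdot>\<^bsub>C\<^esub> t = d0 \<cdot>\<^bsub>C\<^esub> p \<and> d1 \<cdot>\<^bsub>C\<^esub> t = d1 \<cdot>\<^bsub>C\<^esub> q))"

definition exact_category :: "('o, 'a) cat \<Rightarrow> bool" where
  "exact_category C \<longleftrightarrow>
     regular_category C \<and>
     (\<forall>R X d0 d1. is_equivalence_relation C R X d0 d1 \<longrightarrow> (\<exists>f. is_kernel_pair C f d0 d1))"

definition coexact_category :: "('o, 'a) cat \<Rightarrow> bool" where
  "coexact_category C \<longleftrightarrow> exact_category (op_cat C)"


section \<open>Coproducts and Condition P\<close>

definition is_coproduct ::
  "('o, 'a) cat \<Rightarrow> 'i set \<Rightarrow> ('i \<Rightarrow> 'o) \<Rightarrow> 'o \<Rightarrow> ('i \<Rightarrow> 'a) \<Rightarrow> bool" where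
  "is_coproduct C I A Q \<iota> \<longleftrightarrow>
     Q \<in> Obj C \<and> (\<forall>i \<in> I. \<iota> i \<in> Hom C (A i) Q) \<and>
     (\<forall>x \<in> Obj C. \<forall>f. (\<forall>i \<in> I. f i \<in> Hom C (A i) x) \<longrightarrow>
        (\<exists>!h. h \<in> Hom C Q x \<and> (\<forall>i \<in> I. h \<cdot>\<^bsub>C\<^esub> \<iota> i = f i)))"

definition has_finite_coproducts :: "('o, 'a) cat \<Rightarrow> bool" where
  "has_finite_coproducts C \<longleftrightarrow>
     (\<forall>(I :: nat set) A. finite I \<and> (\<forall>i \<in> I. A i \<in> Obj C) \<longrightarrow> (\<exists>Q \<iota>. is_coproduct C I A Q \<iota>))"

text \<open>
  The arrows \<open>i\<close> and \<open>j\<close> are the injections of a coproduct of \<open>a\<close> and \<open>b\<close>; the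
  coproduct object is their common codomain.
\<close>

definition is_binary_coproduct :: "('o, 'a) cat \<Rightarrow> 'o \<Rightarrow> 'o \<Rightarrow> 'a \<Rightarrow> 'a \<Rightarrow> bool" where
  "is_binary_coproduct C a b i j \<longleftrightarrow>
     i \<in> Hom C a (cod C i) \<and> j \<in> Hom C b (cod C i) \<and>
     (\<forall>x f g. f \<in> Hom C a x \<and> g \<in> Hom C b x \<longrightarrow>
        (\<exists>!h. h \<in> Hom C (cod C i) x \<and> h \<cdot>\<^bsub>C\<^esub> i = f \<and> h \<cdot>\<^bsub>C\<^esub> j = g))"

text \<open>\<open>[f, g]\<close>, on the coproduct with injections \<open>i\<close> and \<open>j\<close>.\<close>

definition copair :: "('o, 'a) cat \<Rightarrow> 'a \<Rightarrow> 'a \<Rightarrow> 'a \<Rightarrow> 'a \<Rightarrow> 'a" where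
  "copair C i j f g =
     (THE h. h \<in> Hom C (cod C i) (cod C f) \<and> h \<cdot>\<^bsub>C\<^esub> i = f \<and> h \<cdot>\<^bsub>C\<^esub> j = g)"

text \<open>\<open>f + g\<close>, from the coproduct with injections \<open>i, j\<close> to the one with injections \<open>i', j'\<close>.\<close>

definition coproduct_map :: "('o, 'a) cat \<Rightarrow> 'a \<Rightarrow> 'a \<Rightarrow> 'a \<Rightarrow> 'a \<Rightarrow> 'a \<Rightarrow> 'a \<Rightarrow> 'a" where
  "coproduct_map C i j i' j' f g = copair C i j (i' \<cdot>\<^bsub>C\<^esub> f) (j' \<cdot>\<^bsub>C\<^esub> g)"

text \<open>
  In the following three conditions the coproducts are arbitrary. As coproducts are unique up
  to isomorphism, this is the same as fixing a choice of binary coproducts.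
\<close>

definition coproducts_preserve_pullbacks :: "('o, 'a) cat \<Rightarrow> bool" where
  "coproducts_preserve_pullbacks C \<longleftrightarrow>
     (\<forall>f g p q f' g' p' q' iP jP iX jX iY jY iZ jZ.
        is_pullback C f g p q \<and> is_pullback C f' g' p' q' \<and>
        is_binary_coproduct C (dom C p) (dom C p') iP jP \<and>
        is_binary_coproduct C (dom C f) (dom C f') iX jX \<and>
        is_binary_coproduct C (dom C g) (dom C g') iY jY \<and>
        is_binary_coproduct C (cod C f) (cod C f') iZ jZ \<longrightarrow>
        is_pullback C
          (coproduct_map C iX jX iZ jZ f f')
          (coproduct_map C iY jY iZ jZ g g')
          (coproduct_map C iP jP iX jX p p')
          (coproduct_map C iP jP iY jY q q'))"

text \<open>
  Bottom \<open>m : S \<rightarrow> A\<close>, right \<open>[1, m] : A + S \<rightarrow> A\<close>, left \<open>[1, 1] : S + S \<rightarrow> S\<close>,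
  top \<open>m + 1 : S + S \<rightarrow> A + S\<close>, with \<open>i, j\<close> the injections into \<open>S + S\<close> and
  \<open>i', j'\<close> those into \<open>A + S\<close>.
\<close>

definition mono_squares_are_pullbacks :: "('o, 'a) cat \<Rightarrow> bool" where
  "mono_squares_are_pullbacks C \<longleftrightarrow>
     (\<forall>S A m i j i' j'.
        m \<in> Hom C S A \<and> is_mono C m \<and>
        is_binary_coproduct C S S i j \<and> is_binary_coproduct C A S i' j' \<longrightarrow>
        is_pullback C m (copair C i' j' (ident C A) m)
          (copair C i j (ident C S) (ident C S))
          (coproduct_map C i j i' j' m (ident C S)))"

text \<open>
  Bottom \<open>p : E \<rightarrow> B\<close>, right \<open>[1, 1] : B + B \<rightarrow> B\<close>, left \<open>[1, 1] : E + E \<rightarrow> E\<close>,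
  top \<open>p + p : E + E \<rightarrow> B + B\<close>, with \<open>i, j\<close> the injections into \<open>E + E\<close> and
  \<open>i', j'\<close> those into \<open>B + B\<close>.
\<close>

definition regular_epi_squares_are_feeble_pullbacks :: "('o, 'a) cat \<Rightarrow> bool" where
  "regular_epi_squares_are_feeble_pullbacks C \<longleftrightarrow>
     (\<forall>E B p i j i' j'.
        p \<in> Hom C E B \<and> is_regular_epi C p \<and>
        is_binary_coproduct C E E i j \<and> is_binary_coproduct C B B i' j' \<longrightarrow>
        is_feeble_pullback C p (copair C i' j' (ident C B) (ident C B))
          (copair C i j (ident C E) (ident C E))
          (coproduct_map C i j i' j' p p))"

definition condition_P :: "('o, 'a) cat \<Rightarrow> bool" where
  "condition_P C \<longleftrightarrow>
     has_finite_coproducts C \<and>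
     coproducts_preserve_pullbacks C \<and>
     mono_squares_are_pullbacks C \<and>
     regular_epi_squares_are_feeble_pullbacks C"

end

theory Submission
  imports Defs
begin

text \<open>
  Condition (b) and the feeble pullbacks (d) say that pulling back along a regular epimorphism
  preserves binary coproducts up to a regular epimorphism, and (b), (c) compute pullbacks of
  \<open>[m, g]\<close> along a monomorphism \<open>m\<close>. With these two tools the expected formula, from sets, for
  the equivalence relation that defines a pushout of a monomorphism \<open>m\<close> along a monomorphism or
  a regular epimorphism can be verified to be an equivalence relation, and by exactness it is the
  kernel pair of a quotient. Computing in that kernel pair shows that every monomorphism is an
  equalizer and that pushouts of monomorphisms are monomorphisms; this is regularity of the
  opposite category. For a corelation \<open>d0, d1 : X \<rightarrow> R\<close> with common retraction and
  equalizer \<open>S\<close>, the map \<open>[d0, d1] : X + X \<rightarrow> R\<close> is a regular epimorphism, and its kernel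
  pair is covered by \<open>(X + S) + (S + X)\<close>, on which every \<open>[g0, g1]\<close> with \<open>g0, g1\<close>
  equal on \<open>S\<close> takes equal values. Hence \<open>R\<close> is the cokernel pair of \<open>S\<close>.
\<close>

section \<open>Arrows, pullbacks and regular epimorphisms\<close>

text \<open>Arrows \<open>Z -> X\<close> serve as generalized elements, and existence claims are
  made only after composing with a regular epimorphism \<open>z\<close>, a cover of
  \<open>Z\<close>. Covers are unavoidable because (d) yields only a feeble pullback. What is found
  on a cover descends: equations because regular epimorphisms cancel, factorizations through a
  monomorphism by orthogonality. The relations are given by legs \<open>c, d\<close> out of a
  coproduct that need not be jointly monic. They are tested with the Euclidean law (a R b and a R b'
  imply b R b') because its premise involves only the kernel pair of the one leg \<open>c\<close>.
  This leg is a cotuple [1, f] or a sum of two such, and for these (b), (c), (d) compute pullbacks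
  up to covers. Pushouts are never computed to show that they preserve monomorphisms. Any
  commutative square with a monic leg is enough, since that leg factors through the leg of the
  pushout, which is then monic too. Pushing out along an arbitrary arrow is reduced to the two
  special cases by its image factorization.\<close>

context category
begin

lemma HomD:
  assumes "f \<in> Hom C a b"
  shows "f \<in> Arr C" "dom C f = a" "cod C f = b" "a \<in> Obj C" "b \<in> Obj C"
  using assms dom_closed cod_closed by (auto simp: Hom_def)

lemma HomI: "f \<in> Arr C \<Longrightarrow> dom C f = a \<Longrightarrow> cod C f = b \<Longrightarrow> f \<in> Hom C a b"
  by (simp add: Hom_def)

lemma Hom_iff: "f \<in> Hom C a b \<longleftrightarrow> f \<in> Arr C \<and> dom C f = a \<and> cod C f = b"
  by (simp add: Hom_def)

text \<open>The laws of the locale are restated with \<open>Arr\<close>, \<open>dom\<close> and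
  \<open>cod\<close> in place of \<open>Hom\<close>, so that the simplifier can discharge the typing
  conditions. Composites are nested to the right.\<close>

lemma
  assumes "f \<in> Arr C" "g \<in> Arr C" "dom C g = cod C f"
  shows comp_Arr [simp]: "g \<cdot> f \<in> Arr C"
    and dom_comp [simp]: "dom C (g \<cdot> f) = dom C f"
    and cod_comp [simp]: "cod C (g \<cdot> f) = cod C g"
  using comp_closed[of f "dom C f" "cod C f" g "cod C g"] assms by (auto simp: Hom_def)

lemma
  assumes "a \<in> Obj C"
  shows ident_Arr [simp]: "ident C a \<in> Arr C"
    and dom_ident [simp]: "dom C (ident C a) = a"
    and cod_ident [simp]: "cod C (ident C a) = a"
  using ident_closed[OF assms] by (auto simp: Hom_def)

lemma comp_assoc_Arr [simp]:
  assumes "f \<in> Arr C" "g \<in> Arr C" "h \<in> Arr C" "dom C g = cod C f" "dom C h = cod C g"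
  shows "h \<cdot> g \<cdot> f = h \<cdot> (g \<cdot> f)"
  using comp_assoc[of f "dom C f" "cod C f" g "cod C g" h "cod C h"] assms by (auto simp: Hom_def)

lemma comp_ident [simp]: "f \<in> Arr C \<Longrightarrow> dom C f = a \<Longrightarrow> f \<cdot> ident C a = f"
  by (rule ident_right[of f a "cod C f"]) (simp add: Hom_def)

lemma ident_comp [simp]: "f \<in> Arr C \<Longrightarrow> cod C f = a \<Longrightarrow> ident C a \<cdot> f = f"
  by (rule ident_left[of f "dom C f" a]) (simp add: Hom_def)

declare dom_closed [simp] cod_closed [simp]

text \<open>In right-nested form, \<open>g \<cdot> f\<close> is not a subterm of
  \<open>g \<cdot> (f \<cdot> w)\<close>, so a known equation for it has to be supplied together
  with a tail \<open>w\<close>.\<close>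

lemma comp_reassoc:
  assumes "g \<cdot> f = h" "f \<in> Arr C" "g \<in> Arr C" "dom C g = cod C f" "w \<in> Arr C" "cod C w = dom C f"
  shows "g \<cdot> (f \<cdot> w) = h \<cdot> w"
  using assms comp_assoc_Arr[of w f g] by simp

section \<open>Pullback squares\<close>

lemma is_pullbackD:
  assumes "is_pullback C f g p q"
  shows "f \<in> Arr C" "g \<in> Arr C" "p \<in> Arr C" "q \<in> Arr C" "dom C q = dom C p"
    "cod C p = dom C f" "cod C q = dom C g" "cod C g = cod C f" "f \<cdot> p = g \<cdot> q"
  using assms by (auto simp: is_pullback_def commutative_square_def Hom_def)

lemma pullback_lift:
  assumes "is_pullback C f g p q" "u \<in> Hom C Z (dom C f)" "v \<in> Hom C Z (dom C g)" "f \<cdot> u = g \<cdot> v"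
  obtains h where "h \<in> Hom C Z (dom C p)" "p \<cdot> h = u" "q \<cdot> h = v"
proof -
  have "commutative_square C f g u v"
    using assms is_pullbackD[OF assms(1)] by (auto simp: commutative_square_def Hom_def)
  then obtain h where "h \<in> Hom C (dom C u) (dom C p)" "p \<cdot> h = u" "q \<cdot> h = v"
    using assms(1) unfolding is_pullback_def by blast
  then show thesis using assms(2) that by (auto simp: Hom_def)
qed

lemma pullback_joint_mono:
  assumes "is_pullback C f g p q" "h \<in> Hom C Z (dom C p)" "k \<in> Hom C Z (dom C p)"
    "p \<cdot> h = p \<cdot> k" "q \<cdot> h = q \<cdot> k"
  shows "h = k"
proof -
  note [simp] = is_pullbackD[OF assms(1)] HomD[OF assms(2)] HomD[OF assms(3)]
  have "commutative_square C f g (p \<cdot> h) (q \<cdot> h)"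
    using comp_reassoc[OF is_pullbackD(9)[OF assms(1)], of h]
    by (auto simp: commutative_square_def Hom_def)
  then have "\<exists>!x. x \<in> Hom C (dom C (p \<cdot> h)) (dom C p) \<and> p \<cdot> x = p \<cdot> h \<and> q \<cdot> x = q \<cdot> h"
    using assms(1) unfolding is_pullback_def by blast
  moreover have "h \<in> Hom C (dom C (p \<cdot> h)) (dom C p)" "k \<in> Hom C (dom C (p \<cdot> h)) (dom C p)"
    by (auto simp: Hom_def)
  ultimately show ?thesis using assms(4,5) by metis
qed

lemma is_pullbackI:
  assumes "f \<in> Hom C X Y" "g \<in> Hom C X' Y" "p \<in> Hom C P X" "q \<in> Hom C P X'" "f \<cdot> p = g \<cdot> q"
    and lift: "\<And>Z u v. u \<in> Hom C Z X \<Longrightarrow> v \<in> Hom C Z X' \<Longrightarrow> f \<cdot> u = g \<cdot> v \<Longrightarrow>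
      \<exists>h \<in> Hom C Z P. p \<cdot> h = u \<and> q \<cdot> h = v"
    and uniq: "\<And>Z h k. h \<in> Hom C Z P \<Longrightarrow> k \<in> Hom C Z P \<Longrightarrow> p \<cdot> h = p \<cdot> k \<Longrightarrow> q \<cdot> h = q \<cdot> k \<Longrightarrow> h = k"
  shows "is_pullback C f g p q"
  unfolding is_pullback_def
proof (intro conjI allI impI)
  show "commutative_square C f g p q"
    using assms(1-5) by (auto simp: commutative_square_def Hom_def)
  fix u v
  assume "commutative_square C f g u v"
  then have uv: "u \<in> Hom C (dom C u) X" "v \<in> Hom C (dom C u) X'" "f \<cdot> u = g \<cdot> v"
    using assms(1,2) by (auto simp: commutative_square_def Hom_def)
  from lift[OF this] obtain h where "h \<in> Hom C (dom C u) P" "p \<cdot> h = u" "q \<cdot> h = v" by blast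
  moreover have "dom C p = P" using assms(3) by (simp add: Hom_def)
  ultimately show "\<exists>!h. h \<in> Hom C (dom C u) (dom C p) \<and> p \<cdot> h = u \<and> q \<cdot> h = v"
    using uniq by (intro ex1I[of _ h]) auto
qed

lemma pullback_sym:
  assumes "is_pullback C f g p q"
  shows "is_pullback C g f q p"
proof -
  note [simp] = is_pullbackD[OF assms]
  show ?thesis
  proof (rule is_pullbackI)
    fix Z u v
    assume "u \<in> Hom C Z (dom C g)" "v \<in> Hom C Z (dom C f)" "g \<cdot> u = f \<cdot> v"
    then show "\<exists>h \<in> Hom C Z (dom C p). q \<cdot> h = u \<and> p \<cdot> h = v"
      by (metis pullback_lift[OF assms])
  next
    fix Z h k
    assume "h \<in> Hom C Z (dom C p)" "k \<in> Hom C Z (dom C p)" "q \<cdot> h = q \<cdot> k" "p \<cdot> h = p \<cdot> k"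
    then show "h = k" using pullback_joint_mono[OF assms] by blast
  qed (auto simp: Hom_def)
qed

lemma pullback_ident:
  assumes "f \<in> Hom C A B"
  shows "is_pullback C f (ident C B) (ident C A) f"
proof -
  note [simp] = HomD[OF assms]
  show ?thesis
  proof (rule is_pullbackI[OF assms])
    fix Z u v
    assume u: "u \<in> Hom C Z A" and v: "v \<in> Hom C Z B" and "f \<cdot> u = ident C B \<cdot> v"
    then show "\<exists>h \<in> Hom C Z A. ident C A \<cdot> h = u \<and> f \<cdot> h = v"
      using HomD[OF u] HomD[OF v] by (intro bexI[of _ u]) simp_all
  next
    fix Z h k
    assume h: "h \<in> Hom C Z A" and k: "k \<in> Hom C Z A" and "ident C A \<cdot> h = ident C A \<cdot> k"
    then show "h = k" using HomD[OF h] HomD[OF k] by simp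
  qed (simp_all add: Hom_def)
qed

section \<open>Monomorphisms\<close>

lemma is_monoD:
  assumes "is_mono C m" "g \<in> Hom C x (dom C m)" "h \<in> Hom C x (dom C m)" "m \<cdot> g = m \<cdot> h"
  shows "g = h"
  using assms unfolding is_mono_def by blast

lemma is_monoI:
  assumes "m \<in> Hom C S A"
    and "\<And>x g h. g \<in> Hom C x S \<Longrightarrow> h \<in> Hom C x S \<Longrightarrow> m \<cdot> g = m \<cdot> h \<Longrightarrow> g = h"
  shows "is_mono C m"
  using assms unfolding is_mono_def Hom_def by blast

text \<open>As a pullback square, monicity becomes accessible to condition (b).\<close>

lemma is_mono_iff_pullback:
  assumes "m \<in> Hom C S A"
  shows "is_mono C m \<longleftrightarrow> is_pullback C m m (ident C S) (ident C S)"
proof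
  note [simp] = HomD[OF assms]
  assume mono: "is_mono C m"
  show "is_pullback C m m (ident C S) (ident C S)"
  proof (rule is_pullbackI[OF assms assms])
    fix Z u v
    assume u: "u \<in> Hom C Z S" and v: "v \<in> Hom C Z S" and "m \<cdot> u = m \<cdot> v"
    then have "u = v" using is_monoD[OF mono] by simp
    then show "\<exists>h \<in> Hom C Z S. ident C S \<cdot> h = u \<and> ident C S \<cdot> h = v"
      using u HomD[OF u] by (intro bexI[of _ u]) simp_all
  next
    fix Z h k
    assume h: "h \<in> Hom C Z S" and k: "k \<in> Hom C Z S" and "ident C S \<cdot> h = ident C S \<cdot> k"
    then show "h = k" using HomD[OF h] HomD[OF k] by simp
  qed (simp_all add: Hom_def)
next
  note [simp] = HomD[OF assms]
  assume pb: "is_pullback C m m (ident C S) (ident C S)"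
  show "is_mono C m"
  proof (rule is_monoI[OF assms])
    fix x g h
    assume g: "g \<in> Hom C x S" and h: "h \<in> Hom C x S" and "m \<cdot> g = m \<cdot> h"
    then obtain k where "k \<in> Hom C x S" "ident C S \<cdot> k = g" "ident C S \<cdot> k = h"
      using pullback_lift[OF pb, of g x h] by auto
    then show "g = h" by simp
  qed
qed

section \<open>Coequalizers and regular epimorphisms\<close>

lemma is_coequalizerD:
  assumes "is_coequalizer C u v q"
  shows "u \<in> Arr C" "v \<in> Arr C" "q \<in> Arr C" "dom C v = dom C u" "cod C v = cod C u"
    "dom C q = cod C u" "q \<cdot> u = q \<cdot> v"
  using assms by (auto simp: is_coequalizer_def Hom_def)

lemma coequalizer_factor:
  assumes "is_coequalizer C u v q" "h \<in> Hom C (cod C u) x" "h \<cdot> u = h \<cdot> v"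
  obtains k where "k \<in> Hom C (cod C q) x" "k \<cdot> q = h"
  using assms unfolding is_coequalizer_def by blast

lemma is_coequalizerI:
  assumes "u \<in> Hom C K X" "v \<in> Hom C K X" "q \<in> Hom C X Q" "q \<cdot> u = q \<cdot> v"
    and factor: "\<And>Z h. h \<in> Hom C X Z \<Longrightarrow> h \<cdot> u = h \<cdot> v \<Longrightarrow> \<exists>k \<in> Hom C Q Z. k \<cdot> q = h"
    and epi: "\<And>Z h k. h \<in> Hom C Q Z \<Longrightarrow> k \<in> Hom C Q Z \<Longrightarrow> h \<cdot> q = k \<cdot> q \<Longrightarrow> h = k"
  shows "is_coequalizer C u v q"
  unfolding is_coequalizer_def
proof (intro conjI allI impI)
  fix x h
  assume "h \<in> Hom C (cod C u) x \<and> h \<cdot> u = h \<cdot> v"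
  then obtain k where "k \<in> Hom C Q x" "k \<cdot> q = h"
    using factor assms(1) by (metis HomD(3))
  moreover have "cod C q = Q" using assms(3) by (simp add: Hom_def)
  ultimately show "\<exists>!k. k \<in> Hom C (cod C q) x \<and> k \<cdot> q = h"
    using epi by (intro ex1I[of _ k]) auto
qed (use assms(1-4) in \<open>auto simp: Hom_def\<close>)

lemma regular_epi_Arr: "is_regular_epi C p \<Longrightarrow> p \<in> Arr C"
  unfolding is_regular_epi_def using is_coequalizerD by blast

lemma regular_epi_cancel:
  assumes "is_regular_epi C p" "h \<in> Hom C (cod C p) x" "k \<in> Hom C (cod C p) x" "h \<cdot> p = k \<cdot> p"
  shows "h = k"
proof -
  from assms(1) obtain u v where uv: "is_coequalizer C u v p" unfolding is_regular_epi_def by blast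
  note [simp] = is_coequalizerD[OF uv] HomD[OF assms(2)]
  have "h \<cdot> p \<in> Hom C (cod C u) x" by (simp add: Hom_def)
  moreover have "(h \<cdot> p) \<cdot> u = (h \<cdot> p) \<cdot> v" by simp
  ultimately have "\<exists>!y. y \<in> Hom C (cod C p) x \<and> y \<cdot> p = h \<cdot> p"
    using uv unfolding is_coequalizer_def by blast
  then show ?thesis using assms by metis
qed

text \<open>The arrow \<open>p\<close> is the coequalizer of the idempotent
  \<open>s \<cdot> p\<close> and the identity.\<close>

lemma split_epi_regular:
  assumes "p \<in> Hom C E B" "s \<in> Hom C B E" "p \<cdot> s = ident C B"
  shows "is_regular_epi C p"
proof -
  note [simp] = HomD[OF assms(1)] HomD[OF assms(2)] assms(3) comp_reassoc[OF assms(3)]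
  have "is_coequalizer C (s \<cdot> p) (ident C E) p"
  proof (rule is_coequalizerI[where K = E and X = E and Q = B])
    fix Z h
    assume h: "h \<in> Hom C E Z" and "h \<cdot> (s \<cdot> p) = h \<cdot> ident C E"
    then have "h \<cdot> s \<in> Hom C B Z" "(h \<cdot> s) \<cdot> p = h" using HomD[OF h] by (auto simp: Hom_def)
    then show "\<exists>k \<in> Hom C B Z. k \<cdot> p = h" by blast
  next
    fix Z h k
    assume h: "h \<in> Hom C B Z" and k: "k \<in> Hom C B Z" and eq: "h \<cdot> p = k \<cdot> p"
    from eq have "(h \<cdot> p) \<cdot> s = (k \<cdot> p) \<cdot> s" by simp
    then show "h = k" using HomD[OF h] HomD[OF k] by simp
  qed (auto simp: Hom_def)
  then show ?thesis unfolding is_regular_epi_def by blast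
qed

text \<open>Orthogonality of regular epimorphisms and monomorphisms: cancelling \<open>m\<close>
  shows that \<open>h\<close> coequalizes the pair defining \<open>p\<close>, so \<open>h\<close>
  factors through \<open>p\<close>. It removes the cover \<open>p\<close> from a factorization
  through \<open>m\<close>.\<close>

lemma regular_epi_factor_mono:
  assumes "is_regular_epi C p" "is_mono C m" "g \<in> Hom C (cod C p) A" "cod C m = A"
    "h \<in> Hom C (dom C p) (dom C m)" "g \<cdot> p = m \<cdot> h"
  obtains k where "k \<in> Hom C (cod C p) (dom C m)" "g = m \<cdot> k"
proof -
  from assms(1) obtain u v where uv: "is_coequalizer C u v p" unfolding is_regular_epi_def by blast
  have m: "m \<in> Arr C" using assms(2) by (simp add: is_mono_def)
  note [simp] = is_coequalizerD[OF uv] HomD[OF assms(3)] HomD[OF assms(5)] m assms(4)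
  have "m \<cdot> (h \<cdot> u) = (m \<cdot> h) \<cdot> u" by simp
  also have "\<dots> = (m \<cdot> h) \<cdot> v" unfolding assms(6)[symmetric] by simp
  finally have "m \<cdot> (h \<cdot> u) = m \<cdot> (h \<cdot> v)" by simp
  then have "h \<cdot> u = h \<cdot> v"
    using is_monoD[OF assms(2), of "h \<cdot> u" "dom C u" "h \<cdot> v"] by (simp add: Hom_def)
  then obtain k where k: "k \<in> Hom C (cod C p) (dom C m)" "k \<cdot> p = h"
    using coequalizer_factor[OF uv, of h "dom C m"] by (auto simp: Hom_def)
  note [simp] = HomD[OF k(1)]
  have "g = m \<cdot> k"
    by (rule regular_epi_cancel[OF assms(1,3)]) (simp_all add: Hom_def k(2) assms(6))
  then show thesis using that k(1) by blast
qed

end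


section \<open>Products and pullbacks from finite limits\<close>

text \<open>The free category on a graph without composable edges. Numbers below \<open>n\<close>
  are the vertices and also their identities, and the \<open>k\<close> edges are numbered from
  \<open>n\<close> on, which fits the shapes on natural numbers in
  \<open>finitely_complete\<close>.\<close>

definition graph_category :: "nat \<Rightarrow> nat \<Rightarrow> (nat \<Rightarrow> nat) \<Rightarrow> (nat \<Rightarrow> nat) \<Rightarrow> (nat, nat) cat" where
  "graph_category n k s t =
     \<lparr>Obj = {..<n}, Arr = {..<n + k}, dom = (\<lambda>a. if a < n then a else s a),
      cod = (\<lambda>a. if a < n then a else t a), ident = (\<lambda>a. a),
      comp = (\<lambda>g f. if f < n then g else f)\<rparr>"

text \<open>
  Since no source of an edge is a target of an edge, one of any two composable arrows is an
  identity, which the composition of \<open>graph_category\<close> relies on.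
\<close>

lemma category_graph_category:
  assumes "\<And>a. n \<le> a \<Longrightarrow> a < n + k \<Longrightarrow> s a < n \<and> t a < n"
    and "\<And>a b. n \<le> a \<Longrightarrow> a < n + k \<Longrightarrow> n \<le> b \<Longrightarrow> b < n + k \<Longrightarrow> t a \<noteq> s b"
  shows "category (graph_category n k s t)"
proof -
  have "\<not> n \<le> s a" "\<not> n \<le> t a" if "n \<le> a" "a < n + k" for a
    using assms(1)[OF that] by simp_all
  moreover have "s b \<noteq> t a" if "n \<le> a" "a < n + k" "n \<le> b" "b < n + k" for a b
    using assms(2)[OF that] by simp
  ultimately show ?thesis
    using assms by unfold_locales (auto simp: graph_category_def Hom_def not_less split: if_splits)
qed

lemma is_functor_graph_category:
  fixes C :: "('o, 'a) cat" and n k :: nat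
  assumes "category C"
    and "\<And>a. n \<le> a \<Longrightarrow> a < n + k \<Longrightarrow> s a < n \<and> t a < n"
    and "\<And>a b. n \<le> a \<Longrightarrow> a < n + k \<Longrightarrow> n \<le> b \<Longrightarrow> b < n + k \<Longrightarrow> t a \<noteq> s b"
    and "\<And>i. i < n \<Longrightarrow> D i \<in> Obj C"
    and "\<And>a. n \<le> a \<Longrightarrow> a < n + k \<Longrightarrow> F a \<in> Hom C (D (s a)) (D (t a))"
  shows "is_functor (graph_category n k s t) C D (\<lambda>a. if a < n then ident C (D a) else F a)"
proof -
  interpret category C by fact
  have "s b \<noteq> t a" if "n \<le> a" "a < n + k" "n \<le> b" "b < n + k" for a b
    using assms(3)[OF that] by simp
  then show ?thesis
    unfolding is_functor_def graph_category_def
    using assms(2-) by (auto simp: Hom_def not_less)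
qed

text \<open>The cone condition is automatic at identities, so a limit is described by one equation
  per edge.\<close>

lemma finitely_complete_graph_limit:
  fixes C :: "('o, 'a) cat" (structure) and n k :: nat
  assumes "category C" "finitely_complete C"
    and "\<And>a. n \<le> a \<Longrightarrow> a < n + k \<Longrightarrow> s a < n \<and> t a < n"
    and "\<And>a b. n \<le> a \<Longrightarrow> a < n + k \<Longrightarrow> n \<le> b \<Longrightarrow> b < n + k \<Longrightarrow> t a \<noteq> s b"
    and "\<And>i. i < n \<Longrightarrow> D i \<in> Obj C"
    and "\<And>a. n \<le> a \<Longrightarrow> a < n + k \<Longrightarrow> F a \<in> Hom C (D (s a)) (D (t a))"
  obtains L \<pi> where "\<And>i. i < n \<Longrightarrow> \<pi> i \<in> Hom C L (D i)"
    and "\<And>a. n \<le> a \<Longrightarrow> a < n + k \<Longrightarrow> F a \<cdot>\<^bsub>C\<^esub> \<pi> (s a) = \<pi> (t a)"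
    and "\<And>M \<sigma>. M \<in> Obj C \<Longrightarrow> (\<And>i. i < n \<Longrightarrow> \<sigma> i \<in> Hom C M (D i)) \<Longrightarrow>
      (\<And>a. n \<le> a \<Longrightarrow> a < n + k \<Longrightarrow> F a \<cdot>\<^bsub>C\<^esub> \<sigma> (s a) = \<sigma> (t a)) \<Longrightarrow>
      \<exists>!h. h \<in> Hom C M L \<and> (\<forall>i<n. \<pi> i \<cdot>\<^bsub>C\<^esub> h = \<sigma> i)"
proof -
  interpret category C by fact
  let ?J = "graph_category n k s t"
  let ?F = "\<lambda>a. if a < n then ident C (D a) else F a"
  have "category ?J" using assms(3,4) by (rule category_graph_category)
  moreover have "is_functor ?J C D ?F" using assms(1,3-) by (rule is_functor_graph_category)
  moreover have "finite (Obj ?J)" "finite (Arr ?J)" by (auto simp: graph_category_def)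
  ultimately obtain L \<pi> where lim: "is_limit ?J C D ?F L \<pi>"
    using assms(2) unfolding finitely_complete_def by blast
  have cone: "is_cone ?J C D ?F M \<sigma> \<longleftrightarrow> M \<in> Obj C \<and> (\<forall>i<n. \<sigma> i \<in> Hom C M (D i)) \<and>
      (\<forall>a. n \<le> a \<longrightarrow> a < n + k \<longrightarrow> F a \<cdot> \<sigma> (s a) = \<sigma> (t a))" for M \<sigma>
    unfolding is_cone_def graph_category_def using assms(3)
    by (auto simp: Hom_def not_less)
  have l: "is_cone ?J C D ?F L \<pi>"
    "\<And>M \<sigma>. is_cone ?J C D ?F M \<sigma> \<Longrightarrow> \<exists>!h. h \<in> Hom C M L \<and> (\<forall>i \<in> Obj ?J. \<pi> i \<cdot> h = \<sigma> i)"
    using lim unfolding is_limit_def by blast+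
  have obj: "(\<forall>i \<in> Obj ?J. P i) \<longleftrightarrow> (\<forall>i<n. P i)" for P
    by (auto simp: graph_category_def)
  show thesis
    by (rule that[of \<pi> L]) (use l in \<open>auto simp: cone obj\<close>)
qed

locale finitely_complete_category = category C for C (structure) +
  assumes finitely_complete: "finitely_complete C"
begin

lemma product_exists:
  assumes "A \<in> Obj C" "B \<in> Obj C"
  obtains P p q where "p \<in> Hom C P A" "q \<in> Hom C P B"
    and "\<And>Z u v. u \<in> Hom C Z A \<Longrightarrow> v \<in> Hom C Z B \<Longrightarrow> \<exists>h \<in> Hom C Z P. p \<cdot> h = u \<and> q \<cdot> h = v"
    and "\<And>Z h k. h \<in> Hom C Z P \<Longrightarrow> k \<in> Hom C Z P \<Longrightarrow> p \<cdot> h = p \<cdot> k \<Longrightarrow> q \<cdot> h = q \<cdot> k \<Longrightarrow> h = k"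
proof -
  define D where "D i = (if i = (0::nat) then A else B)" for i
  \<comment> \<open>Two vertices and no edges, hence arbitrary values for sources, targets and edge
    arrows.\<close>
  obtain P \<pi> where \<pi>: "\<And>i. i < 2 \<Longrightarrow> \<pi> i \<in> Hom C P (D i)"
    and univ: "\<And>M \<sigma>. M \<in> Obj C \<Longrightarrow> (\<And>i. i < 2 \<Longrightarrow> \<sigma> i \<in> Hom C M (D i)) \<Longrightarrow>
      \<exists>!h. h \<in> Hom C M P \<and> (\<forall>i<2. \<pi> i \<cdot> h = \<sigma> i)"
    by (rule finitely_complete_graph_limit[OF category_axioms finitely_complete,
          of 2 0 undefined undefined D undefined])
      (use assms in \<open>auto simp: D_def\<close>)
  have p: "\<pi> 0 \<in> Hom C P A" "\<pi> 1 \<in> Hom C P B" using \<pi>[of 0] \<pi>[of 1] by (auto simp: D_def)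
  have all2: "(\<forall>i<2. Q i) \<longleftrightarrow> Q 0 \<and> Q 1" for Q :: "nat \<Rightarrow> bool"
    by (auto simp: less_2_cases_iff)
  have ex1: "\<exists>!h. h \<in> Hom C Z P \<and> \<pi> 0 \<cdot> h = u \<and> \<pi> 1 \<cdot> h = v"
    if "u \<in> Hom C Z A" "v \<in> Hom C Z B" for Z u v
    using univ[of Z "\<lambda>i. if i = 0 then u else v"] that HomD[OF that(1)]
    by (auto simp: D_def all2)
  show thesis
  proof (rule that[OF p])
    fix Z h k
    assume h: "h \<in> Hom C Z P" and k: "k \<in> Hom C Z P" and "\<pi> 0 \<cdot> h = \<pi> 0 \<cdot> k" "\<pi> 1 \<cdot> h = \<pi> 1 \<cdot> k"
    then show "h = k"
      using ex1[of "\<pi> 0 \<cdot> h" Z "\<pi> 1 \<cdot> h"] p comp_closed[OF h] by metis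
  qed (use ex1 in blast)
qed

lemma pullback_exists:
  assumes "f \<in> Hom C A B" "g \<in> Hom C A' B"
  obtains p q where "is_pullback C f g p q"
proof -
  note [simp] = HomD[OF assms(1)] HomD[OF assms(2)]
  \<comment> \<open>The cospan: vertices 0, 1, 2 carry \<open>A\<close>, \<open>A'\<close>,
    \<open>B\<close>, and the edges 3 and 4 into vertex 2 carry \<open>f\<close> and
    \<open>g\<close>.\<close>
  define D where "D i = (if i = (0::nat) then A else if i = 1 then A' else B)" for i
  define s where "s i = (if i = (3::nat) then 0 else (1::nat))" for i
  define F where "F i = (if i = (3::nat) then f else g)" for i
  have range: "3 \<le> a \<and> a < 3 + 2 \<longleftrightarrow> a = 3 \<or> a = 4" for a :: nat by auto
  have all3: "(\<forall>i<3. Q i) \<longleftrightarrow> Q 0 \<and> Q 1 \<and> Q 2" for Q :: "nat \<Rightarrow> bool"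
    by (auto simp: less_Suc_eq numeral_3_eq_3 numeral_2_eq_2)
  obtain P \<pi> where \<pi>: "\<And>i. i < 3 \<Longrightarrow> \<pi> i \<in> Hom C P (D i)"
    and comm: "\<And>a. 3 \<le> a \<Longrightarrow> a < 3 + 2 \<Longrightarrow> F a \<cdot> \<pi> (s a) = \<pi> 2"
    and univ: "\<And>M \<sigma>. M \<in> Obj C \<Longrightarrow> (\<And>i. i < 3 \<Longrightarrow> \<sigma> i \<in> Hom C M (D i)) \<Longrightarrow>
      (\<And>a. 3 \<le> a \<Longrightarrow> a < 3 + 2 \<Longrightarrow> F a \<cdot> \<sigma> (s a) = \<sigma> 2) \<Longrightarrow>
      \<exists>!h. h \<in> Hom C M P \<and> (\<forall>i<3. \<pi> i \<cdot> h = \<sigma> i)"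
    by (rule finitely_complete_graph_limit[OF category_axioms finitely_complete,
          of 3 2 s "\<lambda>_. 2" D F])
      (use assms in \<open>auto simp: D_def s_def F_def\<close>)
  have p: "\<pi> 0 \<in> Hom C P A" "\<pi> 1 \<in> Hom C P A'" "\<pi> 2 \<in> Hom C P B"
    using \<pi>[of 0] \<pi>[of 1] \<pi>[of 2] by (auto simp: D_def)
  have eq: "f \<cdot> \<pi> 0 = \<pi> 2" "g \<cdot> \<pi> 1 = \<pi> 2"
    using comm[of 3] comm[of 4] by (auto simp: F_def s_def)
  \<comment> \<open>A cone on the cospan has a third leg, into \<open>B\<close>, which is forced to
    be \<open>f \<cdot> u\<close>.\<close>
  have ex1: "\<exists>!h. h \<in> Hom C Z P \<and> \<pi> 0 \<cdot> h = u \<and> \<pi> 1 \<cdot> h = v \<and> \<pi> 2 \<cdot> h = f \<cdot> u"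
    if "u \<in> Hom C Z A" "v \<in> Hom C Z A'" "f \<cdot> u = g \<cdot> v" for Z u v
  proof -
    let ?\<sigma> = "\<lambda>i. if i = (0::nat) then u else if i = 1 then v else f \<cdot> u"
    have "\<exists>!h. h \<in> Hom C Z P \<and> (\<forall>i<3. \<pi> i \<cdot> h = ?\<sigma> i)"
    proof (rule univ)
      show "Z \<in> Obj C" using HomD[OF that(1)] by simp
      show "\<And>i. i < 3 \<Longrightarrow> ?\<sigma> i \<in> Hom C Z (D i)"
        using that HomD[OF that(1)] by (auto simp: D_def Hom_def)
      show "\<And>a. 3 \<le> a \<Longrightarrow> a < 3 + 2 \<Longrightarrow> F a \<cdot> ?\<sigma> (s a) = ?\<sigma> 2"
        using that(3) by (auto simp: F_def s_def)
    qed
    then show ?thesis by (simp add: all3)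
  qed
  have "is_pullback C f g (\<pi> 0) (\<pi> 1)"
  proof (rule is_pullbackI[OF assms p(1,2)])
    fix Z h k
    assume h: "h \<in> Hom C Z P" and k: "k \<in> Hom C Z P"
      and hk: "\<pi> 0 \<cdot> h = \<pi> 0 \<cdot> k" "\<pi> 1 \<cdot> h = \<pi> 1 \<cdot> k"
    have "\<pi> 2 \<cdot> x = f \<cdot> (\<pi> 0 \<cdot> x)" if "x \<in> Hom C Z P" for x
      using comp_reassoc[OF eq(1), of x] HomD[OF that] HomD[OF p(1)] by simp
    moreover have "f \<cdot> (\<pi> 0 \<cdot> h) = g \<cdot> (\<pi> 1 \<cdot> h)"
      using comp_reassoc[OF eq(1), of h] comp_reassoc[OF eq(2), of h]
        HomD[OF h] HomD[OF p(1)] HomD[OF p(2)] by simp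
    ultimately have "\<pi> 2 \<cdot> h = f \<cdot> (\<pi> 0 \<cdot> h)" "\<pi> 2 \<cdot> k = f \<cdot> (\<pi> 0 \<cdot> h)"
      "f \<cdot> (\<pi> 0 \<cdot> h) = g \<cdot> (\<pi> 1 \<cdot> h)"
      using h k hk(1) by simp_all
    then show "h = k"
      using ex1[of "\<pi> 0 \<cdot> h" Z "\<pi> 1 \<cdot> h"] comp_closed[OF h p(1)] comp_closed[OF h p(2)] h k hk by metis
  next
    show "f \<cdot> \<pi> 0 = g \<cdot> \<pi> 1" using eq by simp
    fix Z u v
    assume "u \<in> Hom C Z A" "v \<in> Hom C Z A'" "f \<cdot> u = g \<cdot> v"
    from ex1[OF this] show "\<exists>h \<in> Hom C Z P. \<pi> 0 \<cdot> h = u \<and> \<pi> 1 \<cdot> h = v" by blast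
  qed
  then show thesis by (rule that)
qed

end

section \<open>Regular categories\<close>

locale regular_cat = finitely_complete_category C for C (structure) +
  assumes kernel_pair_coequalizer: "is_kernel_pair C f u v \<Longrightarrow> \<exists>q. is_coequalizer C u v q"
    and regular_epi_pullback: "is_pullback C f g p q \<Longrightarrow> is_regular_epi C f \<Longrightarrow> is_regular_epi C q"
begin

text \<open>Surjectivity on generalized elements: the cover \<open>z\<close> is the pullback of
  \<open>p\<close> along \<open>g\<close>, regular epic by stability.\<close>

lemma regular_epi_lift:
  assumes "is_regular_epi C p" "p \<in> Hom C E B" "g \<in> Hom C Z B"
  obtains Z' z x where "z \<in> Hom C Z' Z" "is_regular_epi C z" "x \<in> Hom C Z' E" "p \<cdot> x = g \<cdot> z"
proof -
  obtain x z where pb: "is_pullback C p g x z" using pullback_exists[OF assms(2,3)] .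
  note [simp] = is_pullbackD[OF pb] HomD[OF assms(2)] HomD[OF assms(3)]
  show thesis
    by (rule that[of z "dom C x" x])
      (simp_all add: Hom_iff regular_epi_pullback[OF pb assms(1)])
qed

text \<open>The arrow \<open>e\<close> is the quotient by the kernel pair of \<open>f\<close>. Two
  elements of \<open>I\<close> with equal images under \<open>n\<close> lift on a cover to elements
  of \<open>X\<close> related by that kernel pair, so \<open>n\<close> is monic.\<close>

lemma image_factorization:
  assumes "f \<in> Hom C X Y"
  obtains I e n where "e \<in> Hom C X I" "n \<in> Hom C I Y" "is_regular_epi C e" "is_mono C n" "f = n \<cdot> e"
proof -
  obtain k1 k2 where pb: "is_pullback C f f k1 k2" using pullback_exists[OF assms assms] .
  then obtain e where e: "is_coequalizer C k1 k2 e"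
    using kernel_pair_coequalizer unfolding is_kernel_pair_def by blast
  note [simp] = HomD[OF assms] is_pullbackD(3-8)[OF pb] is_coequalizerD(1-6)[OF e]
  obtain n where n: "n \<in> Hom C (cod C e) Y" "n \<cdot> e = f"
    using coequalizer_factor[OF e, of f Y] is_pullbackD(9)[OF pb] assms by auto
  note [simp] = HomD[OF n(1)]
  have reg: "is_regular_epi C e" using e unfolding is_regular_epi_def by blast
  have eH: "e \<in> Hom C X (cod C e)" by (simp add: Hom_iff)
  have "is_mono C n"
  proof (rule is_monoI[OF n(1)])
    fix Z g h
    assume g: "g \<in> Hom C Z (cod C e)" and h: "h \<in> Hom C Z (cod C e)" and gh: "n \<cdot> g = n \<cdot> h"
    obtain Z1 z1 x where 1: "z1 \<in> Hom C Z1 Z" "is_regular_epi C z1" "x \<in> Hom C Z1 X" "e \<cdot> x = g \<cdot> z1"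
      using regular_epi_lift[OF reg eH g] .
    have "h \<cdot> z1 \<in> Hom C Z1 (cod C e)" using comp_closed[OF 1(1) h] .
    from regular_epi_lift[OF reg eH this]
    obtain Z2 z2 y where 2: "z2 \<in> Hom C Z2 Z1" "is_regular_epi C z2" "y \<in> Hom C Z2 X"
      "e \<cdot> y = (h \<cdot> z1) \<cdot> z2" .
    note [simp] = HomD[OF g] HomD[OF h] HomD[OF 1(1)] HomD[OF 1(3)] HomD[OF 2(1)] HomD[OF 2(3)]
    have "f \<cdot> (x \<cdot> z2) = n \<cdot> (g \<cdot> (z1 \<cdot> z2))"
    proof -
      have "f \<cdot> (x \<cdot> z2) = n \<cdot> (e \<cdot> (x \<cdot> z2))"
        using comp_reassoc[OF n(2), of "x \<cdot> z2"] by simp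
      then show ?thesis using comp_reassoc[OF 1(4), of z2] by simp
    qed
    moreover have "f \<cdot> y = n \<cdot> (h \<cdot> (z1 \<cdot> z2))"
      using comp_reassoc[OF n(2), of y] 2(4) by simp
    ultimately have "f \<cdot> (x \<cdot> z2) = f \<cdot> y"
      using comp_reassoc[OF gh, of "z1 \<cdot> z2"] by simp
    then obtain t where t: "t \<in> Hom C Z2 (dom C k1)" "k1 \<cdot> t = x \<cdot> z2" "k2 \<cdot> t = y"
      using pullback_lift[OF pb, of "x \<cdot> z2" Z2 y] by (auto simp: Hom_iff)
    note [simp] = HomD[OF t(1)]
    have "(g \<cdot> z1) \<cdot> z2 = e \<cdot> (k1 \<cdot> t)" using comp_reassoc[OF 1(4), of z2] t(2) by simp
    also have "\<dots> = e \<cdot> (k2 \<cdot> t)" using comp_reassoc[OF is_coequalizerD(7)[OF e], of t] by simp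
    also have "\<dots> = (h \<cdot> z1) \<cdot> z2" using t(3) 2(4) by simp
    finally have "(g \<cdot> z1) \<cdot> z2 = (h \<cdot> z1) \<cdot> z2" .
    then have "g \<cdot> z1 = h \<cdot> z1"
      using regular_epi_cancel[OF 2(2), of "g \<cdot> z1" "cod C e" "h \<cdot> z1"] by (simp add: Hom_iff)
    then show "g = h"
      using regular_epi_cancel[OF 1(2), of g "cod C e" h] by (simp add: Hom_iff)
  qed
  then show thesis using that eH n reg by blast
qed

text \<open>The monic part of the image factorization has a section by assumption, hence is an
  isomorphism. So \<open>f\<close> is a coequalizer of the same pair as the regular part.\<close>

lemma regular_epi_of_strong_epi:
  assumes "f \<in> Hom C X Y"
    and "\<And>I e n. e \<in> Hom C X I \<Longrightarrow> n \<in> Hom C I Y \<Longrightarrow> is_mono C n \<Longrightarrow> f = n \<cdot> e \<Longrightarrow>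
      \<exists>k \<in> Hom C Y I. n \<cdot> k = ident C Y"
  shows "is_regular_epi C f"
proof -
  obtain I e n where en: "e \<in> Hom C X I" "n \<in> Hom C I Y" "is_regular_epi C e" "is_mono C n" "f = n \<cdot> e"
    using image_factorization[OF assms(1)] .
  obtain k where k: "k \<in> Hom C Y I" "n \<cdot> k = ident C Y" using assms(2)[OF en(1,2,4,5)] by blast
  note [simp] = HomD[OF en(1)] HomD[OF en(2)] HomD[OF k(1)]
  have kn: "k \<cdot> n = ident C I"
    by (rule is_monoD[OF en(4)]) (use comp_reassoc[OF k(2), of n] in \<open>auto simp: Hom_iff\<close>)
  obtain u v where uv: "is_coequalizer C u v e" using en(3) unfolding is_regular_epi_def by blast
  have uv': "u \<in> Arr C" "v \<in> Arr C" "dom C v = dom C u" "cod C v = X" "cod C u = X" "e \<cdot> u = e \<cdot> v"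
    using is_coequalizerD[OF uv] by simp_all
  note [simp] = uv'(1-5)
  have "is_coequalizer C u v f"
  proof (rule is_coequalizerI[where K = "dom C u" and X = X and Q = Y])
    show "f \<cdot> u = f \<cdot> v" using uv'(6) en(5) by simp
    fix Z h
    assume h: "h \<in> Hom C X Z" and "h \<cdot> u = h \<cdot> v"
    then obtain l where l: "l \<in> Hom C I Z" "l \<cdot> e = h"
      using coequalizer_factor[OF uv, of h Z] by auto
    have "(l \<cdot> k) \<cdot> f = h"
      using HomD[OF l(1)] l(2) en(5) comp_reassoc[OF kn, of e] by simp
    then show "\<exists>k \<in> Hom C Y Z. k \<cdot> f = h" using comp_closed[OF k(1) l(1)] by blast
  next
    fix Z g h
    assume g: "g \<in> Hom C Y Z" and h: "h \<in> Hom C Y Z" and eq: "g \<cdot> f = h \<cdot> f"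
    note [simp] = HomD[OF g] HomD[OF h]
    have "g \<cdot> n = h \<cdot> n"
      by (rule regular_epi_cancel[OF en(3)]) (use eq en(5) in \<open>auto simp: Hom_iff\<close>)
    then have "(g \<cdot> n) \<cdot> k = (h \<cdot> n) \<cdot> k" by simp
    then show "g = h" using k(2) by simp
  qed (use assms(1) in \<open>auto simp: Hom_iff\<close>)
  then show ?thesis unfolding is_regular_epi_def by blast
qed

text \<open>Two diagonal fill-ins: a monomorphism through which the composite factors admits a
  factorization first of \<open>g\<close> and then of the identity.\<close>

lemma regular_epi_comp:
  assumes "is_regular_epi C f" "is_regular_epi C g" "f \<in> Hom C X Y" "g \<in> Hom C Y Z"
  shows "is_regular_epi C (g \<cdot> f)"
proof (rule regular_epi_of_strong_epi)
  show "g \<cdot> f \<in> Hom C X Z" using assms comp_closed by blast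
  note [simp] = HomD[OF assms(3)] HomD[OF assms(4)]
  fix I e n
  assume e: "e \<in> Hom C X I" and n: "n \<in> Hom C I Z" and mono: "is_mono C n" and eq: "g \<cdot> f = n \<cdot> e"
  note [simp] = HomD[OF e] HomD[OF n]
  obtain k where k: "k \<in> Hom C Y I" "g = n \<cdot> k"
    using regular_epi_factor_mono[OF assms(1) mono, of g Z e] assms(4) e eq by auto
  have "ident C Z \<cdot> g = n \<cdot> k" unfolding k(2)[symmetric] by simp
  moreover have "ident C Z \<in> Hom C (cod C g) Z" "k \<in> Hom C (dom C g) (dom C n)" "cod C n = Z"
    using HomD[OF k(1)] by (simp_all add: Hom_iff)
  ultimately obtain l where "l \<in> Hom C (cod C g) (dom C n)" "ident C Z = n \<cdot> l"
    using regular_epi_factor_mono[OF assms(2) mono] by metis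
  then show "\<exists>l \<in> Hom C Z I. n \<cdot> l = ident C Z" by (intro bexI[of _ l]) simp_all
qed

end


section \<open>Chosen binary coproducts\<close>

locale coproduct_category = category C for C (structure) +
  assumes has_finite_coproducts: "has_finite_coproducts C"
begin

lemma initial_exists:
  obtains Z where "Z \<in> Obj C" "\<And>x. x \<in> Obj C \<Longrightarrow> \<exists>!h. h \<in> Hom C Z x"
proof -
  obtain Q \<iota> where "is_coproduct C ({} :: nat set) (\<lambda>_. undefined) Q \<iota>"
    using has_finite_coproducts unfolding has_finite_coproducts_def by fastforce
  then show thesis using that[of Q] unfolding is_coproduct_def by auto
qed

lemma binary_coproduct_exists:
  assumes "a \<in> Obj C" "b \<in> Obj C"
  shows "\<exists>i j. is_binary_coproduct C a b i j"
proof -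
  define A where "A k = (if k = (0::nat) then a else b)" for k
  obtain Q \<iota> where Q: "is_coproduct C {0, 1} A Q \<iota>"
    using has_finite_coproducts assms unfolding has_finite_coproducts_def A_def by fastforce
  have ex: "\<exists>!h. h \<in> Hom C Q x \<and> h \<cdot> \<iota> 0 = f \<and> h \<cdot> \<iota> 1 = g"
    if "f \<in> Hom C a x" "g \<in> Hom C b x" for x f g
  proof -
    have "x \<in> Obj C" using HomD[OF that(1)] by simp
    moreover have "\<forall>i \<in> {0, 1}. (if i = 0 then f else g) \<in> Hom C (A i) x"
      using that by (simp add: A_def)
    moreover have "\<forall>x \<in> Obj C. \<forall>f. (\<forall>i \<in> {0, 1}. f i \<in> Hom C (A i) x) \<longrightarrow>
        (\<exists>!h. h \<in> Hom C Q x \<and> (\<forall>i \<in> {0, 1}. h \<cdot> \<iota> i = f i))"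
      using Q unfolding is_coproduct_def by (elim conjE)
    ultimately have "\<exists>!h. h \<in> Hom C Q x \<and> (\<forall>i \<in> {0, 1}. h \<cdot> \<iota> i = (if i = 0 then f else g))"
      by (elim ballE[of _ _ x] allE[of _ "\<lambda>i. if i = 0 then f else g"]) simp_all
    then show ?thesis by simp
  qed
  have \<iota>: "\<iota> 0 \<in> Hom C a Q" "\<iota> 1 \<in> Hom C b Q"
    using Q unfolding is_coproduct_def A_def by auto
  then have "cod C (\<iota> 0) = Q" by (simp add: Hom_iff)
  then have "is_binary_coproduct C a b (\<iota> 0) (\<iota> 1)"
    using ex \<iota> unfolding is_binary_coproduct_def by simp
  then show ?thesis by blast
qed

text \<open>A fixed choice of injections makes cotuples and sums of arrows into operations.
  Condition P quantifies over all coproducts and so applies to the chosen ones.\<close>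

definition inj_pair :: "'a \<Rightarrow> 'a \<Rightarrow> 'b \<times> 'b" where
  "inj_pair a b = (SOME p. is_binary_coproduct C a b (fst p) (snd p))"

definition inl :: "'a \<Rightarrow> 'a \<Rightarrow> 'b" where "inl a b = fst (inj_pair a b)"

definition inr :: "'a \<Rightarrow> 'a \<Rightarrow> 'b" where "inr a b = snd (inj_pair a b)"

definition coprod :: "'a \<Rightarrow> 'a \<Rightarrow> 'a" where "coprod a b = cod C (inl a b)"

definition cotuple :: "'b \<Rightarrow> 'b \<Rightarrow> 'b" ("\<lbrace>_, _\<rbrace>") where
  "\<lbrace>f, g\<rbrace> = copair C (inl (dom C f) (dom C g)) (inr (dom C f) (dom C g)) f g"

definition coprod_map :: "'b \<Rightarrow> 'b \<Rightarrow> 'b" (infixl "\<oplus>" 65) where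
  "f \<oplus> g = \<lbrace>inl (cod C f) (cod C g) \<cdot> f, inr (cod C f) (cod C g) \<cdot> g\<rbrace>"

lemma binary_coproduct_inl_inr:
  assumes "a \<in> Obj C" "b \<in> Obj C"
  shows "is_binary_coproduct C a b (inl a b) (inr a b)"
proof -
  have "\<exists>p. is_binary_coproduct C a b (fst p) (snd p)"
    using binary_coproduct_exists[OF assms] by simp
  from someI_ex[OF this] show ?thesis by (simp add: inl_def inr_def inj_pair_def)
qed

lemma copairD:
  assumes "is_binary_coproduct C a b i j" "f \<in> Hom C a x" "g \<in> Hom C b x"
  shows "copair C i j f g \<in> Hom C (cod C i) x" "copair C i j f g \<cdot> i = f" "copair C i j f g \<cdot> j = g"
proof -
  have "\<exists>!h. h \<in> Hom C (cod C i) (cod C f) \<and> h \<cdot> i = f \<and> h \<cdot> j = g"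
    using assms HomD(3)[OF assms(2)] unfolding is_binary_coproduct_def by blast
  from theI'[OF this] show "copair C i j f g \<in> Hom C (cod C i) x"
    "copair C i j f g \<cdot> i = f" "copair C i j f g \<cdot> j = g"
    using HomD(3)[OF assms(2)] unfolding copair_def by simp_all
qed

lemma copair_unique:
  assumes "is_binary_coproduct C a b i j" "h \<in> Hom C (cod C i) x" "k \<in> Hom C (cod C i) x"
    "h \<cdot> i = k \<cdot> i" "h \<cdot> j = k \<cdot> j"
  shows "h = k"
proof -
  have i: "i \<in> Hom C a (cod C i)" "j \<in> Hom C b (cod C i)"
    using assms(1) unfolding is_binary_coproduct_def by blast+
  have "\<exists>!l. l \<in> Hom C (cod C i) x \<and> l \<cdot> i = h \<cdot> i \<and> l \<cdot> j = h \<cdot> j"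
    using assms(1) comp_closed[OF i(1) assms(2)] comp_closed[OF i(2) assms(2)]
    unfolding is_binary_coproduct_def by blast
  then show ?thesis using assms(2-) by metis
qed

lemma
  assumes "a \<in> Obj C" "b \<in> Obj C"
  shows inl_Arr [simp]: "inl a b \<in> Arr C" and dom_inl [simp]: "dom C (inl a b) = a"
    and cod_inl [simp]: "cod C (inl a b) = coprod a b"
    and inr_Arr [simp]: "inr a b \<in> Arr C" and dom_inr [simp]: "dom C (inr a b) = b"
    and cod_inr [simp]: "cod C (inr a b) = coprod a b"
    and coprod_Obj [simp]: "coprod a b \<in> Obj C"
  using binary_coproduct_inl_inr[OF assms] cod_closed[of "inl a b"]
  unfolding is_binary_coproduct_def coprod_def Hom_iff by auto

lemma
  assumes "f \<in> Arr C" "g \<in> Arr C" "cod C f = cod C g"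
  shows cotuple_Arr [simp]: "\<lbrace>f, g\<rbrace> \<in> Arr C"
    and dom_cotuple [simp]: "dom C \<lbrace>f, g\<rbrace> = coprod (dom C f) (dom C g)"
    and cod_cotuple [simp]: "cod C \<lbrace>f, g\<rbrace> = cod C g"
    and cotuple_inl': "\<lbrace>f, g\<rbrace> \<cdot> inl (dom C f) (dom C g) = f"
    and cotuple_inr': "\<lbrace>f, g\<rbrace> \<cdot> inr (dom C f) (dom C g) = g"
  using copairD[OF binary_coproduct_inl_inr, of "dom C f" "dom C g" f "cod C g" g] assms
  by (simp_all add: cotuple_def Hom_iff)

lemma cotuple_inl [simp]:
  assumes "f \<in> Arr C" "g \<in> Arr C" "cod C f = cod C g" "dom C f = a" "dom C g = b"
  shows "\<lbrace>f, g\<rbrace> \<cdot> inl a b = f"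
  using cotuple_inl' assms by blast

lemma cotuple_inr [simp]:
  assumes "f \<in> Arr C" "g \<in> Arr C" "cod C f = cod C g" "dom C f = a" "dom C g = b"
  shows "\<lbrace>f, g\<rbrace> \<cdot> inr a b = g"
  using cotuple_inr' assms by blast

lemma cotuple_inl_comp [simp]:
  assumes "f \<in> Arr C" "g \<in> Arr C" "cod C f = cod C g" "dom C f = a" "dom C g = b"
    "w \<in> Arr C" "cod C w = a"
  shows "\<lbrace>f, g\<rbrace> \<cdot> (inl a b \<cdot> w) = f \<cdot> w"
  by (rule comp_reassoc) (use assms in auto)

lemma cotuple_inr_comp [simp]:
  assumes "f \<in> Arr C" "g \<in> Arr C" "cod C f = cod C g" "dom C f = a" "dom C g = b"
    "w \<in> Arr C" "cod C w = b"
  shows "\<lbrace>f, g\<rbrace> \<cdot> (inr a b \<cdot> w) = g \<cdot> w"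
  by (rule comp_reassoc) (use assms in auto)

lemma cotuple_unique:
  assumes "h \<in> Hom C (coprod a b) x" "k \<in> Hom C (coprod a b) x" "a \<in> Obj C" "b \<in> Obj C"
    "h \<cdot> inl a b = k \<cdot> inl a b" "h \<cdot> inr a b = k \<cdot> inr a b"
  shows "h = k"
  using copair_unique[OF binary_coproduct_inl_inr[OF assms(3,4)], of h x k] assms by simp

text \<open>Together with the rules for \<open>inl\<close> and \<open>inr\<close>, this lets the
  simplifier evaluate composites of cotuples and injections. Equations involving \<oplus> are then
  mostly settled by unfolding \<open>coprod_map_def\<close>.\<close>

lemma comp_cotuple [simp]:
  assumes "f \<in> Arr C" "g \<in> Arr C" "cod C f = cod C g" "h \<in> Arr C" "dom C h = cod C g"
  shows "h \<cdot> \<lbrace>f, g\<rbrace> = \<lbrace>h \<cdot> f, h \<cdot> g\<rbrace>"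
  by (rule cotuple_unique[where a = "dom C f" and b = "dom C g" and x = "cod C h"])
    (use assms in \<open>auto simp: Hom_iff\<close>)

lemma comp_cotuple_comp [simp]:
  assumes "f \<in> Arr C" "g \<in> Arr C" "cod C f = cod C g" "h \<in> Arr C" "dom C h = cod C g"
    "w \<in> Arr C" "cod C w = coprod (dom C f) (dom C g)"
  shows "h \<cdot> (\<lbrace>f, g\<rbrace> \<cdot> w) = \<lbrace>h \<cdot> f, h \<cdot> g\<rbrace> \<cdot> w"
  using comp_reassoc[OF comp_cotuple[OF assms(1-5)], of w] assms by simp

lemma cotuple_inl_inr [simp]:
  assumes "a \<in> Obj C" "b \<in> Obj C"
  shows "\<lbrace>inl a b, inr a b\<rbrace> = ident C (coprod a b)"
  by (rule cotuple_unique[where a = a and b = b and x = "coprod a b"])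
    (use assms in \<open>auto simp: Hom_iff\<close>)

lemma cotuple_eta:
  assumes "h \<in> Hom C (coprod a b) x" "a \<in> Obj C" "b \<in> Obj C"
  shows "\<lbrace>h \<cdot> inl a b, h \<cdot> inr a b\<rbrace> = h"
  by (rule cotuple_unique[where a = a and b = b and x = x])
    (use assms HomD[OF assms(1)] in \<open>auto simp: Hom_iff\<close>)

lemma
  assumes "f \<in> Arr C" "g \<in> Arr C"
  shows coprod_map_Arr: "f \<oplus> g \<in> Arr C"
    and dom_coprod_map: "dom C (f \<oplus> g) = coprod (dom C f) (dom C g)"
    and cod_coprod_map: "cod C (f \<oplus> g) = coprod (cod C f) (cod C g)"
  using assms by (simp_all add: coprod_map_def)

lemma coproduct_map_inl_inr:
  assumes "f \<in> Hom C a a'" "g \<in> Hom C b b'"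
  shows "coproduct_map C (inl a b) (inr a b) (inl a' b') (inr a' b') f g = f \<oplus> g"
  using HomD[OF assms(1)] HomD[OF assms(2)]
  by (simp add: coproduct_map_def coprod_map_def cotuple_def)

lemma copair_inl_inr:
  assumes "f \<in> Hom C a x" "g \<in> Hom C b x"
  shows "copair C (inl a b) (inr a b) f g = \<lbrace>f, g\<rbrace>"
  using HomD[OF assms(1)] HomD[OF assms(2)] by (simp add: cotuple_def)

text \<open>Coequalizers commute with coproducts, as both are colimits. This is what combines covers
  of two summands into one cover of their coproduct.\<close>

lemma coprod_map_coequalizer:
  assumes "is_coequalizer C u v p" "is_coequalizer C u' v' p'"
  shows "is_coequalizer C (u \<oplus> u') (v \<oplus> v') (p \<oplus> p')"
proof -
  have eq: "p \<cdot> u = p \<cdot> v" "p' \<cdot> u' = p' \<cdot> v'"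
    using is_coequalizerD(7)[OF assms(1)] is_coequalizerD(7)[OF assms(2)] .
  note [simp] = is_coequalizerD(1-6)[OF assms(1)] is_coequalizerD(1-6)[OF assms(2)]
  let ?X = "cod C u" and ?X' = "cod C u'" and ?Q = "cod C p" and ?Q' = "cod C p'"
  show ?thesis
  proof (rule is_coequalizerI[where K = "coprod (dom C u) (dom C u')" and
        X = "coprod ?X ?X'" and Q = "coprod ?Q ?Q'"])
    show "(p \<oplus> p') \<cdot> (u \<oplus> u') = (p \<oplus> p') \<cdot> (v \<oplus> v')" using eq by (simp add: coprod_map_def)
    fix Z h
    assume h: "h \<in> Hom C (coprod ?X ?X') Z" and hu: "h \<cdot> (u \<oplus> u') = h \<cdot> (v \<oplus> v')"
    note [simp] = HomD[OF h]
    have "(h \<cdot> (u \<oplus> u')) \<cdot> inl (dom C u) (dom C u') = (h \<cdot> (v \<oplus> v')) \<cdot> inl (dom C u) (dom C u')"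
      "(h \<cdot> (u \<oplus> u')) \<cdot> inr (dom C u) (dom C u') = (h \<cdot> (v \<oplus> v')) \<cdot> inr (dom C u) (dom C u')"
      using hu by simp_all
    then have eqs: "(h \<cdot> inl ?X ?X') \<cdot> u = (h \<cdot> inl ?X ?X') \<cdot> v"
      "(h \<cdot> inr ?X ?X') \<cdot> u' = (h \<cdot> inr ?X ?X') \<cdot> v'"
      by (simp_all add: coprod_map_def)
    have homs: "h \<cdot> inl ?X ?X' \<in> Hom C ?X Z" "h \<cdot> inr ?X ?X' \<in> Hom C ?X' Z"
      by (simp_all add: Hom_iff)
    obtain k where k: "k \<in> Hom C ?Q Z" "k \<cdot> p = h \<cdot> inl ?X ?X'"
      using coequalizer_factor[OF assms(1) homs(1) eqs(1)] .
    obtain k' where k': "k' \<in> Hom C ?Q' Z" "k' \<cdot> p' = h \<cdot> inr ?X ?X'"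
      using coequalizer_factor[OF assms(2) homs(2) eqs(2)] .
    note [simp] = HomD[OF k(1)] HomD[OF k'(1)]
    have "\<lbrace>k, k'\<rbrace> \<cdot> (p \<oplus> p') = h"
      using cotuple_eta[OF h] by (simp add: coprod_map_def k(2) k'(2))
    then show "\<exists>k \<in> Hom C (coprod ?Q ?Q') Z. k \<cdot> (p \<oplus> p') = h"
      by (intro bexI[of _ "\<lbrace>k, k'\<rbrace>"]) (simp_all add: Hom_iff)
  next
    fix Z h k
    assume h: "h \<in> Hom C (coprod ?Q ?Q') Z" and k: "k \<in> Hom C (coprod ?Q ?Q') Z"
      and hk: "h \<cdot> (p \<oplus> p') = k \<cdot> (p \<oplus> p')"
    note [simp] = HomD[OF h] HomD[OF k]
    have "(h \<cdot> (p \<oplus> p')) \<cdot> inl ?X ?X' = (k \<cdot> (p \<oplus> p')) \<cdot> inl ?X ?X'"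
      "(h \<cdot> (p \<oplus> p')) \<cdot> inr ?X ?X' = (k \<cdot> (p \<oplus> p')) \<cdot> inr ?X ?X'"
      using hk by simp_all
    then have "(h \<cdot> inl ?Q ?Q') \<cdot> p = (k \<cdot> inl ?Q ?Q') \<cdot> p"
      "(h \<cdot> inr ?Q ?Q') \<cdot> p' = (k \<cdot> inr ?Q ?Q') \<cdot> p'"
      by (simp_all add: coprod_map_def)
    moreover have "is_regular_epi C p" "is_regular_epi C p'"
      using assms unfolding is_regular_epi_def by blast+
    ultimately have "h \<cdot> inl ?Q ?Q' = k \<cdot> inl ?Q ?Q'" "h \<cdot> inr ?Q ?Q' = k \<cdot> inr ?Q ?Q'"
      using regular_epi_cancel[of p "h \<cdot> inl ?Q ?Q'" Z "k \<cdot> inl ?Q ?Q'"]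
        regular_epi_cancel[of p' "h \<cdot> inr ?Q ?Q'" Z "k \<cdot> inr ?Q ?Q'"]
      by (simp_all add: Hom_iff)
    then show "h = k" using cotuple_unique[OF h k] by simp
  qed (simp_all add: coprod_map_def Hom_iff)
qed

lemma coprod_map_regular_epi:
  assumes "is_regular_epi C p" "is_regular_epi C p'"
  shows "is_regular_epi C (p \<oplus> p')"
  using assms coprod_map_coequalizer unfolding is_regular_epi_def by meson

end

section \<open>Condition P\<close>

locale exact_P_category =
  regular_cat C + coproduct_category C for C (structure) +
  assumes effective: "is_equivalence_relation C R X d0 d1 \<Longrightarrow> \<exists>f. is_kernel_pair C f d0 d1"
    and coproducts_preserve_pullbacks: "coproducts_preserve_pullbacks C"
    and mono_squares: "mono_squares_are_pullbacks C"
    and regular_epi_squares: "regular_epi_squares_are_feeble_pullbacks C"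
begin

section \<open>Condition P for the chosen coproducts\<close>

lemma pullback_coprod_map:
  assumes "is_pullback C f g p q" "is_pullback C f' g' p' q'"
  shows "is_pullback C (f \<oplus> f') (g \<oplus> g') (p \<oplus> p') (q \<oplus> q')"
proof -
  note [simp] = is_pullbackD(1-8)[OF assms(1)] is_pullbackD(1-8)[OF assms(2)]
  have coprod: "is_binary_coproduct C (dom C h) (dom C h') (inl (dom C h) (dom C h'))
      (inr (dom C h) (dom C h'))"
    "is_binary_coproduct C (cod C h) (cod C h') (inl (cod C h) (cod C h'))
      (inr (cod C h) (cod C h'))"
    if "h \<in> Arr C" "h' \<in> Arr C" for h h'
    using that by (auto intro: binary_coproduct_inl_inr)
  have "is_pullback C
      (coproduct_map C (inl (dom C f) (dom C f')) (inr (dom C f) (dom C f'))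
        (inl (cod C f) (cod C f')) (inr (cod C f) (cod C f')) f f')
      (coproduct_map C (inl (dom C g) (dom C g')) (inr (dom C g) (dom C g'))
        (inl (cod C f) (cod C f')) (inr (cod C f) (cod C f')) g g')
      (coproduct_map C (inl (dom C p) (dom C p')) (inr (dom C p) (dom C p'))
        (inl (dom C f) (dom C f')) (inr (dom C f) (dom C f')) p p')
      (coproduct_map C (inl (dom C p) (dom C p')) (inr (dom C p) (dom C p'))
        (inl (dom C g) (dom C g')) (inr (dom C g) (dom C g')) q q')"
    using coproducts_preserve_pullbacks[unfolded coproducts_preserve_pullbacks_def, rule_format]
      assms coprod[of p p'] coprod[of f f'] coprod[of g g'] by simp
  then show ?thesis
    by (simp add: coproduct_map_inl_inr Hom_iff)
qed

lemma mono_square_pullback: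
  assumes "m \<in> Hom C S A" "is_mono C m"
  shows "is_pullback C m \<lbrace>ident C A, m\<rbrace> \<lbrace>ident C S, ident C S\<rbrace> (m \<oplus> ident C S)"
proof -
  note [simp] = HomD[OF assms(1)]
  have "is_pullback C m (copair C (inl A S) (inr A S) (ident C A) m)
      (copair C (inl S S) (inr S S) (ident C S) (ident C S))
      (coproduct_map C (inl S S) (inr S S) (inl A S) (inr A S) m (ident C S))"
    using mono_squares[unfolded mono_squares_are_pullbacks_def, rule_format]
      assms binary_coproduct_inl_inr[of S S] binary_coproduct_inl_inr[of A S] by simp
  then show ?thesis
    by (simp add: coproduct_map_inl_inr copair_inl_inr Hom_iff)
qed

lemma regular_epi_square_feeble_pullback:
  assumes "p \<in> Hom C E B" "is_regular_epi C p"
  shows "is_feeble_pullback C p \<lbrace>ident C B, ident C B\<rbrace> \<lbrace>ident C E, ident C E\<rbrace> (p \<oplus> p)"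
proof -
  note [simp] = HomD[OF assms(1)]
  have "is_feeble_pullback C p (copair C (inl B B) (inr B B) (ident C B) (ident C B))
      (copair C (inl E E) (inr E E) (ident C E) (ident C E))
      (coproduct_map C (inl E E) (inr E E) (inl B B) (inr B B) p p)"
    using regular_epi_squares[unfolded regular_epi_squares_are_feeble_pullbacks_def, rule_format]
      assms binary_coproduct_inl_inr[of E E] binary_coproduct_inl_inr[of B B] by simp
  then show ?thesis
    by (simp add: coproduct_map_inl_inr copair_inl_inr Hom_iff)
qed

text \<open>
  Pulling back along a regular epimorphism preserves binary coproducts up to a regular
  epimorphism.
\<close>

lemma regular_epi_pullback_coprod_cover:
  assumes "p \<in> Hom C E B" "is_regular_epi C p"
    and pb1: "is_pullback C p g1 a1 b1" and pb2: "is_pullback C p g2 a2 b2"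
    and x: "x \<in> Hom C Z (coprod (dom C g1) (dom C g2))" and y: "y \<in> Hom C Z E"
    and eq: "p \<cdot> y = \<lbrace>g1, g2\<rbrace> \<cdot> x"
  obtains Z' z w where "z \<in> Hom C Z' Z" "is_regular_epi C z"
    "w \<in> Hom C Z' (coprod (dom C a1) (dom C a2))"
    "\<lbrace>a1, a2\<rbrace> \<cdot> w = y \<cdot> z" "(b1 \<oplus> b2) \<cdot> w = x \<cdot> z"
proof -
  note [simp] = HomD[OF assms(1)] HomD[OF x] HomD[OF y]
    is_pullbackD(2-8)[OF pb1] is_pullbackD(2-8)[OF pb2]
  obtain \<pi>1 \<pi>2 h where pb: "is_pullback C p \<lbrace>ident C B, ident C B\<rbrace> \<pi>1 \<pi>2"
    and h: "h \<in> Hom C (coprod E E) (dom C \<pi>1)" "\<pi>1 \<cdot> h = \<lbrace>ident C E, ident C E\<rbrace>"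
      "\<pi>2 \<cdot> h = p \<oplus> p" "is_regular_epi C h"
    using regular_epi_square_feeble_pullback[OF assms(1,2)] unfolding is_feeble_pullback_def by auto
  note [simp] = is_pullbackD(3-7)[OF pb] HomD[OF h(1)]
  \<comment> \<open>Since [g1, g2] is the codiagonal after \<open>g1 \<oplus> g2\<close>, these two
    arrows form an element of the pullback of \<open>p\<close> along the codiagonal of
    \<open>B\<close>. By (d), \<open>E + E\<close> covers that pullback.\<close>
  have "y \<in> Hom C Z (dom C p)"
    "(g1 \<oplus> g2) \<cdot> x \<in> Hom C Z (dom C \<lbrace>ident C B, ident C B\<rbrace>)"
    "p \<cdot> y = \<lbrace>ident C B, ident C B\<rbrace> \<cdot> ((g1 \<oplus> g2) \<cdot> x)"
    using eq by (simp_all add: Hom_iff coprod_map_def)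
  then obtain k where k: "k \<in> Hom C Z (dom C \<pi>1)" "\<pi>1 \<cdot> k = y" "\<pi>2 \<cdot> k = (g1 \<oplus> g2) \<cdot> x"
    using pullback_lift[OF pb] by metis
  obtain Z' z t where z: "z \<in> Hom C Z' Z" "is_regular_epi C z" and t: "t \<in> Hom C Z' (coprod E E)"
    "h \<cdot> t = k \<cdot> z"
    using regular_epi_lift[OF h(4) h(1) k(1)] .
  note [simp] = HomD[OF k(1)] HomD[OF z(1)] HomD[OF t(1)]
  have t1: "\<lbrace>ident C E, ident C E\<rbrace> \<cdot> t = y \<cdot> z"
    using comp_reassoc[OF h(2), of t] comp_reassoc[OF k(2), of z] t(2) by simp
  have t2: "(p \<oplus> p) \<cdot> t = (g1 \<oplus> g2) \<cdot> (x \<cdot> z)"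
    using comp_reassoc[OF h(3), of t] comp_reassoc[OF k(3), of z] t(2)
    by (simp add: coprod_map_def)
  \<comment> \<open>By (b) the sum of the two given squares is the pullback of
    \<open>p \<oplus> p\<close> along \<open>g1 \<oplus> g2\<close>, which receives \<open>t\<close>
    and \<open>x \<cdot> z\<close>.\<close>
  note pbs = pullback_coprod_map[OF pb1 pb2]
  obtain w where w: "w \<in> Hom C Z' (dom C (a1 \<oplus> a2))" "(a1 \<oplus> a2) \<cdot> w = t" "(b1 \<oplus> b2) \<cdot> w = x \<cdot> z"
    by (rule pullback_lift[OF pbs, of t Z' "x \<cdot> z"])
      (use t2 in \<open>simp_all add: Hom_iff coprod_map_def\<close>)
  have wH: "w \<in> Hom C Z' (coprod (dom C a1) (dom C a2))"
    using w(1) by (simp add: coprod_map_def)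
  note [simp] = HomD[OF wH]
  have "\<lbrace>a1, a2\<rbrace> \<cdot> w = \<lbrace>ident C E, ident C E\<rbrace> \<cdot> ((a1 \<oplus> a2) \<cdot> w)"
    by (simp add: coprod_map_def)
  then have "\<lbrace>a1, a2\<rbrace> \<cdot> w = y \<cdot> z" unfolding w(2) t1 .
  then show thesis using that[OF z wH _ w(3)] by blast
qed

text \<open>The pullback of \<open>m\<close> along [1, m g] is \<open>S + Y\<close>. Indeed [1, m g]
  is [1, m] after \<open>ident C A \<oplus> g\<close>, so the square of (c) is pasted with the sum
  of two trivial pullbacks, of \<open>m\<close> along an identity and of an identity along
  \<open>g\<close>.\<close>

lemma mono_pullback_cotuple_through:
  assumes m: "m \<in> Hom C S A" "is_mono C m" and g: "g \<in> Hom C Y S"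
    and x: "x \<in> Hom C Z (coprod A Y)" and s: "s \<in> Hom C Z S"
    and eq: "m \<cdot> s = \<lbrace>ident C A, m \<cdot> g\<rbrace> \<cdot> x"
  obtains w where "w \<in> Hom C Z (coprod S Y)" "(m \<oplus> ident C Y) \<cdot> w = x" "\<lbrace>ident C S, g\<rbrace> \<cdot> w = s"
proof -
  note [simp] = HomD[OF m(1)] HomD[OF g] HomD[OF x] HomD[OF s]
  obtain w' where w': "w' \<in> Hom C Z (dom C \<lbrace>ident C S, ident C S\<rbrace>)"
    "\<lbrace>ident C S, ident C S\<rbrace> \<cdot> w' = s" "(m \<oplus> ident C S) \<cdot> w' = (ident C A \<oplus> g) \<cdot> x"
    by (rule pullback_lift[OF mono_square_pullback[OF m], of s Z "(ident C A \<oplus> g) \<cdot> x"])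
      (use eq in \<open>simp_all add: Hom_iff coprod_map_def\<close>)
  have pb: "is_pullback C (m \<oplus> ident C S) (ident C A \<oplus> g) (ident C S \<oplus> g) (m \<oplus> ident C Y)"
    by (rule pullback_coprod_map[OF pullback_ident[OF m(1)] pullback_sym[OF pullback_ident[OF g]]])
  have "w' \<in> Hom C Z (coprod S S)" using w'(1) by simp
  note [simp] = HomD[OF this]
  obtain w where w: "w \<in> Hom C Z (dom C (ident C S \<oplus> g))" "(ident C S \<oplus> g) \<cdot> w = w'"
    "(m \<oplus> ident C Y) \<cdot> w = x"
    by (rule pullback_lift[OF pb, of w' Z x]) (use w'(3) in \<open>simp_all add: Hom_iff coprod_map_def\<close>)
  have wH: "w \<in> Hom C Z (coprod S Y)" using w(1) by (simp add: coprod_map_def)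
  note [simp] = HomD[OF wH]
  have "\<lbrace>ident C S, g\<rbrace> \<cdot> w = \<lbrace>ident C S, ident C S\<rbrace> \<cdot> ((ident C S \<oplus> g) \<cdot> w)"
    by (simp add: coprod_map_def)
  then show thesis using that[OF wH w(3)] w(2) w'(2) by simp
qed

text \<open>The pullback of \<open>m\<close> along [m, g] is \<open>S\<close> plus the pullback of
  \<open>m\<close> along \<open>g\<close>. It is again obtained by pasting the square of (c) with a
  sum of pullbacks.\<close>

lemma mono_pullback_cotuple:
  assumes m: "m \<in> Hom C S A" "is_mono C m" and pb: "is_pullback C m g a b"
    and x: "x \<in> Hom C Z (coprod S (dom C g))" and s: "s \<in> Hom C Z S"
    and eq: "m \<cdot> s = \<lbrace>m, g\<rbrace> \<cdot> x"
  obtains w where "w \<in> Hom C Z (coprod S (dom C a))" "(ident C S \<oplus> b) \<cdot> w = x"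
    "\<lbrace>ident C S, a\<rbrace> \<cdot> w = s"
proof -
  note [simp] = HomD[OF m(1)] is_pullbackD(2-8)[OF pb] HomD[OF x] HomD[OF s]
  \<comment> \<open>The summands are exchanged because (c) has \<open>m\<close> on the right
    summand; \<open>w''\<close> undoes the exchange.\<close>
  let ?x' = "\<lbrace>inr A S, inl A S \<cdot> g\<rbrace> \<cdot> x"
  obtain w' where w': "w' \<in> Hom C Z (dom C \<lbrace>ident C S, ident C S\<rbrace>)"
    "\<lbrace>ident C S, ident C S\<rbrace> \<cdot> w' = s" "(m \<oplus> ident C S) \<cdot> w' = ?x'"
    by (rule pullback_lift[OF mono_square_pullback[OF m], of s Z ?x'])
      (use eq in \<open>simp_all add: Hom_iff coprod_map_def\<close>)
  have "w' \<in> Hom C Z (coprod S S)" using w'(1) by simp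
  note [simp] = HomD[OF this]
  define w'' where "w'' = \<lbrace>inr S S, inl S S\<rbrace> \<cdot> w'"
  have w''H: "w'' \<in> Hom C Z (coprod S S)" by (simp add: w''_def Hom_iff)
  have "\<lbrace>inr S A, inl S A\<rbrace> \<cdot> ((m \<oplus> ident C S) \<cdot> w') = \<lbrace>inr S A, inl S A\<rbrace> \<cdot> ?x'"
    unfolding w'(3) ..
  then have comm: "(ident C S \<oplus> m) \<cdot> w'' = (ident C S \<oplus> g) \<cdot> x"
    by (simp add: w''_def coprod_map_def)
  have "is_pullback C (ident C S) (ident C S) (ident C S) (ident C S)"
    using pullback_ident[of "ident C S" S S] by (simp add: Hom_iff)
  note pbs = pullback_coprod_map[OF this pb]
  obtain w where w: "w \<in> Hom C Z (dom C (ident C S \<oplus> a))" "(ident C S \<oplus> a) \<cdot> w = w''"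
    "(ident C S \<oplus> b) \<cdot> w = x"
    by (rule pullback_lift[OF pbs, of w'' Z x])
      (use comm w''H in \<open>simp_all add: Hom_iff coprod_map_def\<close>)
  have wH: "w \<in> Hom C Z (coprod S (dom C a))" using w(1) by (simp add: coprod_map_def)
  note [simp] = HomD[OF wH]
  have "\<lbrace>ident C S, a\<rbrace> \<cdot> w = \<lbrace>ident C S, ident C S\<rbrace> \<cdot> ((ident C S \<oplus> a) \<cdot> w)"
    by (simp add: coprod_map_def)
  also have "\<dots> = s" unfolding w(2) using w'(2) by (simp add: w''_def)
  finally show thesis using that[OF wH w(3)] by blast
qed

text \<open>By (b), the squares expressing monicity of \<open>m\<close> and of \<open>n\<close> add
  up to the one for \<open>m \<oplus> n\<close>.\<close>

lemma coprod_map_mono: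
  assumes "is_mono C m" "is_mono C n"
  shows "is_mono C (m \<oplus> n)"
proof -
  have [simp]: "m \<in> Arr C" "n \<in> Arr C" using assms by (simp_all add: is_mono_def)
  let ?S = "dom C m" and ?T = "dom C n"
  have "is_pullback C (m \<oplus> n) (m \<oplus> n) (ident C ?S \<oplus> ident C ?T) (ident C ?S \<oplus> ident C ?T)"
    using assms is_mono_iff_pullback[of m ?S "cod C m"] is_mono_iff_pullback[of n ?T "cod C n"]
    by (intro pullback_coprod_map) (simp_all add: Hom_iff)
  moreover have "ident C ?S \<oplus> ident C ?T = ident C (coprod ?S ?T)"
    by (simp add: coprod_map_def)
  ultimately show ?thesis
    using is_mono_iff_pullback[of "m \<oplus> n" "coprod ?S ?T" "coprod (cod C m) (cod C n)"]
    by (simp add: Hom_iff coprod_map_def)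
qed

text \<open>The square formed by \<open>n\<close>, \<open>ident C A \<oplus> n\<close> and the two
  right injections is a pullback: by (b) it is the sum of the pullback of \<open>ident C A\<close>
  along the arrow from the initial object and the pullback of \<open>n\<close> along an
  identity.\<close>

lemma inr_factor:
  assumes n: "n \<in> Hom C S B" and A: "A \<in> Obj C" and y: "y \<in> Hom C Z B"
    and w: "w \<in> Hom C Z (coprod A S)" and eq: "inr A B \<cdot> y = (ident C A \<oplus> n) \<cdot> w"
  obtains s where "s \<in> Hom C Z S" "n \<cdot> s = y"
proof -
  note [simp] = HomD[OF n] A HomD[OF y] HomD[OF w]
  obtain I where I: "I \<in> Obj C" "\<And>x. x \<in> Obj C \<Longrightarrow> \<exists>!h. h \<in> Hom C I x"
    using initial_exists by blast
  define i where "i x = (SOME h. h \<in> Hom C I x)" for x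
  have iH: "i x \<in> Hom C I x" if "x \<in> Obj C" for x
    using I(2)[OF that] someI_ex[of "\<lambda>h. h \<in> Hom C I x"] unfolding i_def by blast
  have iU: "f = i (cod C f)" if "f \<in> Arr C" "dom C f = I" for f
    using I(2)[of "cod C f"] iH[of "cod C f"] HomI[OF that refl] that(1) by auto
  note [simp] = I(1) HomD[OF iH]
  \<comment> \<open>Condition (b) accepts any coproduct, so \<open>x\<close> itself can stand for
    the coproduct of the initial object and \<open>x\<close>. The summed square then has the corners
    \<open>S\<close> and \<open>B\<close> exactly.\<close>
  have coprod_initial: "is_binary_coproduct C I x (i x) (ident C x)" if [simp]: "x \<in> Obj C" for x
    unfolding is_binary_coproduct_def
  proof (intro conjI allI impI)
    fix z f g
    assume fg: "f \<in> Hom C I z \<and> g \<in> Hom C x z"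
    then have [simp]: "f \<in> Arr C" "dom C f = I" "cod C f = z" "g \<in> Arr C" "dom C g = x" "cod C g = z"
      by (simp_all add: Hom_iff)
    have "g \<cdot> i x = f" using iU[of f] iU[of "g \<cdot> i x"] by simp
    then show "\<exists>!h. h \<in> Hom C (cod C (i x)) z \<and> h \<cdot> i x = f \<and> h \<cdot> ident C x = g"
    proof (intro ex1I[of _ g])
      fix h
      assume "h \<in> Hom C (cod C (i x)) z \<and> h \<cdot> i x = f \<and> h \<cdot> ident C x = g"
      then have "h \<in> Arr C" "dom C h = x" and eq: "h \<cdot> ident C x = g" by (simp_all add: Hom_iff)
      then show "h = g" by simp
    qed (simp add: Hom_iff)
  qed (simp_all add: Hom_iff)
  have coprod_map_right: "coproduct_map C (i x) (ident C x) k l f g = l \<cdot> g"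
    if "x \<in> Obj C" "k \<cdot> f \<in> Hom C I z" "l \<cdot> g \<in> Hom C x z" for x k l f g z
    using copairD(1,3)[OF coprod_initial[OF that(1)] that(2,3)] that(1)
    by (simp add: coproduct_map_def Hom_iff)
  have pb1: "is_pullback C (ident C A) (i A) (i A) (ident C I)"
    using pullback_sym[OF pullback_ident[OF iH[OF A]]] .
  have "is_pullback C
      (coproduct_map C (inl A S) (inr A S) (inl A B) (inr A B) (ident C A) n)
      (coproduct_map C (i B) (ident C B) (inl A B) (inr A B) (i A) (ident C B))
      (coproduct_map C (i S) (ident C S) (inl A S) (inr A S) (i A) (ident C S))
      (coproduct_map C (i S) (ident C S) (i B) (ident C B) (ident C I) n)"
    using coproducts_preserve_pullbacks[unfolded coproducts_preserve_pullbacks_def, rule_format]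
      pb1 pullback_ident[OF n] coprod_initial[of S] coprod_initial[of B]
      binary_coproduct_inl_inr[of A S] binary_coproduct_inl_inr[of A B] by simp
  moreover have "coproduct_map C (inl A S) (inr A S) (inl A B) (inr A B) (ident C A) n = ident C A \<oplus> n"
    by (rule coproduct_map_inl_inr) (simp_all add: Hom_iff)
  moreover have "coproduct_map C (i B) (ident C B) (inl A B) (inr A B) (i A) (ident C B) = inr A B"
    by (subst coprod_map_right[of _ _ _ "coprod A B"]) (simp_all add: Hom_iff)
  moreover have "coproduct_map C (i S) (ident C S) (inl A S) (inr A S) (i A) (ident C S) = inr A S"
    by (subst coprod_map_right[of _ _ _ "coprod A S"]) (simp_all add: Hom_iff)
  moreover have "coproduct_map C (i S) (ident C S) (i B) (ident C B) (ident C I) n = n"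
    by (subst coprod_map_right[of _ _ _ B]) (simp_all add: Hom_iff)
  ultimately have pb: "is_pullback C (ident C A \<oplus> n) (inr A B) (inr A S) n" by simp
  show thesis
    by (rule pullback_lift[OF pb, of w Z y]) (use eq that in \<open>simp_all add: Hom_iff coprod_map_def\<close>)
qed


section \<open>Quotients of Euclidean graphs\<close>

text \<open>
  A reflexive graph \<open>c, d : T \<rightarrow> X\<close> whose image in \<open>X \<times> X\<close> is a Euclidean relation, tested on
  generalized elements up to regular epimorphisms. Reflexive Euclidean relations are
  equivalence relations, so exactness provides the quotient.
\<close>

lemma euclidean_quotient:
  assumes c: "c \<in> Hom C T X" and d: "d \<in> Hom C T X"
    and r: "r \<in> Hom C X T" "c \<cdot> r = ident C X" "d \<cdot> r = ident C X"
    and euclid: "\<And>Z x y. x \<in> Hom C Z T \<Longrightarrow> y \<in> Hom C Z T \<Longrightarrow> c \<cdot> x = c \<cdot> y \<Longrightarrow>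
      \<exists>Z' z t. z \<in> Hom C Z' Z \<and> is_regular_epi C z \<and> t \<in> Hom C Z' T \<and>
        c \<cdot> t = d \<cdot> (x \<cdot> z) \<and> d \<cdot> t = d \<cdot> (y \<cdot> z)"
  obtains Q q where "q \<in> Hom C X Q" "q \<cdot> c = q \<cdot> d"
    "\<And>Z x y. x \<in> Hom C Z X \<Longrightarrow> y \<in> Hom C Z X \<Longrightarrow> q \<cdot> x = q \<cdot> y \<Longrightarrow>
      \<exists>Z' z t. z \<in> Hom C Z' Z \<and> is_regular_epi C z \<and> t \<in> Hom C Z' T \<and> c \<cdot> t = x \<cdot> z \<and> d \<cdot> t = y \<cdot> z"
proof -
  note [simp] = HomD[OF c] HomD[OF d] HomD[OF r(1)]
  obtain P p0 p1 where p: "p0 \<in> Hom C P X" "p1 \<in> Hom C P X"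
    and pair: "\<And>Z u v. u \<in> Hom C Z X \<Longrightarrow> v \<in> Hom C Z X \<Longrightarrow> \<exists>h \<in> Hom C Z P. p0 \<cdot> h = u \<and> p1 \<cdot> h = v"
    and pair_unique: "\<And>Z h k. h \<in> Hom C Z P \<Longrightarrow> k \<in> Hom C Z P \<Longrightarrow> p0 \<cdot> h = p0 \<cdot> k \<Longrightarrow>
      p1 \<cdot> h = p1 \<cdot> k \<Longrightarrow> h = k"
    using product_exists[of X X] by (metis HomD(5) c)
  note [simp] = HomD[OF p(1)] HomD[OF p(2)]
  obtain cd where cd: "cd \<in> Hom C T P" "p0 \<cdot> cd = c" "p1 \<cdot> cd = d" using pair[OF c d] by blast
  \<comment> \<open>The pair \<open>c, d\<close> need not be jointly monic; the relation proper is
    its image \<open>R\<close> in \<open>X \<times> X\<close>.\<close>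
  obtain R e n where e: "e \<in> Hom C T R" "is_regular_epi C e" and n: "n \<in> Hom C R P" "is_mono C n"
    and ne: "cd = n \<cdot> e"
    using image_factorization[OF cd(1)] by metis
  note [simp] = HomD[OF cd(1)] HomD[OF e(1)] HomD[OF n(1)]
  define d0 where "d0 = p0 \<cdot> n"
  define d1 where "d1 = p1 \<cdot> n"
  have dH: "d0 \<in> Hom C R X" "d1 \<in> Hom C R X" by (simp_all add: d0_def d1_def Hom_iff)
  note [simp] = HomD[OF dH(1)] HomD[OF dH(2)]
  have d0e: "d0 \<cdot> e = c" and d1e: "d1 \<cdot> e = d"
    using cd(2,3) unfolding ne d0_def d1_def by simp_all
  have joint: "g = h" if "g \<in> Hom C Z R" "h \<in> Hom C Z R" "d0 \<cdot> g = d0 \<cdot> h" "d1 \<cdot> g = d1 \<cdot> h" for Z g h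
  proof -
    note [simp] = HomD[OF that(1)] HomD[OF that(2)]
    have "n \<cdot> g = n \<cdot> h"
      using pair_unique[of "n \<cdot> g" Z "n \<cdot> h"] that(3,4) by (simp add: d0_def d1_def Hom_iff)
    then show ?thesis using is_monoD[OF n(2), of g Z h] that(1,2) by simp
  qed
  \<comment> \<open>A pair that is related through \<open>T\<close> on a cover lies in
    \<open>R\<close> itself, since \<open>R\<close> is a subobject of
    \<open>X \<times> X\<close>.\<close>
  have factor: "\<exists>k \<in> Hom C Y R. d0 \<cdot> k = u \<and> d1 \<cdot> k = v"
    if asm: "z \<in> Hom C Z Y" "is_regular_epi C z" "u \<in> Hom C Y X" "v \<in> Hom C Y X"
      "t \<in> Hom C Z T" "c \<cdot> t = u \<cdot> z" "d \<cdot> t = v \<cdot> z" for Y Z z u v t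
  proof -
    note [simp] = HomD[OF asm(1)] HomD[OF asm(3)] HomD[OF asm(4)] HomD[OF asm(5)]
    obtain h where h: "h \<in> Hom C Y P" "p0 \<cdot> h = u" "p1 \<cdot> h = v" using pair[OF asm(3,4)] by blast
    note [simp] = HomD[OF h(1)]
    have "h \<cdot> z = n \<cdot> (e \<cdot> t)"
    proof (rule pair_unique)
      show "p0 \<cdot> (h \<cdot> z) = p0 \<cdot> (n \<cdot> (e \<cdot> t))"
        using comp_reassoc[OF h(2), of z] comp_reassoc[OF d0e, of t] asm(6) by (simp add: d0_def)
      show "p1 \<cdot> (h \<cdot> z) = p1 \<cdot> (n \<cdot> (e \<cdot> t))"
        using comp_reassoc[OF h(3), of z] comp_reassoc[OF d1e, of t] asm(7) by (simp add: d1_def)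
    qed (simp_all add: Hom_iff)
    moreover have "h \<in> Hom C (cod C z) P" "cod C n = P" "e \<cdot> t \<in> Hom C (dom C z) (dom C n)"
      by (simp_all add: Hom_iff)
    ultimately obtain k where k: "k \<in> Hom C (cod C z) (dom C n)" "h = n \<cdot> k"
      using regular_epi_factor_mono[OF asm(2) n(2)] by metis
    have "k \<in> Hom C Y R" using k(1) by simp
    note [simp] = HomD[OF this]
    have "d0 \<cdot> k = u" "d1 \<cdot> k = v" using h(2,3) unfolding k(2) d0_def d1_def by simp_all
    then show ?thesis using \<open>k \<in> Hom C Y R\<close> by blast
  qed
  have symm: "\<exists>Z' z t'. z \<in> Hom C Z' Z \<and> is_regular_epi C z \<and> t' \<in> Hom C Z' T \<and>
      c \<cdot> t' = d \<cdot> (t \<cdot> z) \<and> d \<cdot> t' = c \<cdot> (t \<cdot> z)" if asm: "t \<in> Hom C Z T" for Z t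
  proof -
    note [simp] = HomD[OF asm]
    \<comment> \<open>Symmetry is the Euclidean law for \<open>t\<close> and the loop at
      \<open>c \<cdot> t\<close>.\<close>
    have "r \<cdot> (c \<cdot> t) \<in> Hom C Z T" "c \<cdot> t = c \<cdot> (r \<cdot> (c \<cdot> t))"
      using comp_reassoc[OF r(2), of "c \<cdot> t"] by (simp_all add: Hom_iff)
    from euclid[OF asm this] obtain Z' z t' where z: "z \<in> Hom C Z' Z" "is_regular_epi C z"
      "t' \<in> Hom C Z' T" "c \<cdot> t' = d \<cdot> (t \<cdot> z)" "d \<cdot> t' = d \<cdot> ((r \<cdot> (c \<cdot> t)) \<cdot> z)" by blast
    moreover have "d \<cdot> ((r \<cdot> (c \<cdot> t)) \<cdot> z) = c \<cdot> (t \<cdot> z)"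
      using HomD[OF z(1)] comp_reassoc[OF r(3), of "c \<cdot> (t \<cdot> z)"] by simp
    ultimately show ?thesis by metis
  qed
  have refl: "\<exists>\<rho> \<in> Hom C X R. d0 \<cdot> \<rho> = ident C X \<and> d1 \<cdot> \<rho> = ident C X"
    using comp_closed[OF r(1) e(1)] comp_reassoc[OF d0e, of r] comp_reassoc[OF d1e, of r] r(2,3)
    by (intro bexI[of _ "e \<cdot> r"]) simp_all
  have sym: "\<exists>s \<in> Hom C R R. d0 \<cdot> s = d1 \<and> d1 \<cdot> s = d0"
  proof -
    \<comment> \<open>The generic element of \<open>T\<close> suffices, because
      \<open>e \<cdot> z\<close> covers \<open>R\<close>.\<close>
    have "ident C T \<in> Hom C T T" by (simp add: Hom_iff)
    from symm[OF this] obtain Z z t where z: "z \<in> Hom C Z T" "is_regular_epi C z" "t \<in> Hom C Z T"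
      "c \<cdot> t = d \<cdot> (ident C T \<cdot> z)" "d \<cdot> t = c \<cdot> (ident C T \<cdot> z)" by blast
    note [simp] = HomD[OF z(1)]
    show ?thesis
    proof (rule factor[of "e \<cdot> z" Z R d1 d0 t])
      show "is_regular_epi C (e \<cdot> z)" using regular_epi_comp[OF z(2) e(2) z(1) e(1)] .
      show "c \<cdot> t = d1 \<cdot> (e \<cdot> z)" "d \<cdot> t = d0 \<cdot> (e \<cdot> z)"
        using z(4,5) comp_reassoc[OF d1e, of z] comp_reassoc[OF d0e, of z] by simp_all
    qed (use z dH in \<open>simp_all add: Hom_iff\<close>)
  qed
  obtain p q where pq: "is_pullback C d1 d0 p q" using pullback_exists[OF dH(2,1)] .
  note [simp] = is_pullbackD(3-7)[OF pq]
  have trans: "\<exists>t \<in> Hom C (dom C p) R. d0 \<cdot> t = d0 \<cdot> p \<and> d1 \<cdot> t = d1 \<cdot> q"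
  proof -
    have pH: "p \<in> Hom C (dom C p) R" "q \<in> Hom C (dom C p) R" by (simp_all add: Hom_iff)
    \<comment> \<open>On a cover, \<open>p\<close> and \<open>q\<close> lift to \<open>t1\<close>
      and \<open>t2\<close> in \<open>T\<close>. Reversing \<open>t1\<close> gives
      \<open>t3\<close>, which starts where \<open>t2\<close> starts, so the Euclidean law yields
      \<open>t4\<close> from the start of \<open>t1\<close> to the end of \<open>t2\<close>.\<close>
    obtain Z1 z1 t1 where 1: "z1 \<in> Hom C Z1 (dom C p)" "is_regular_epi C z1" "t1 \<in> Hom C Z1 T"
      "e \<cdot> t1 = p \<cdot> z1" using regular_epi_lift[OF e(2,1) pH(1)] .
    obtain Z2 z2 t2 where 2: "z2 \<in> Hom C Z2 Z1" "is_regular_epi C z2" "t2 \<in> Hom C Z2 T"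
      "e \<cdot> t2 = (q \<cdot> z1) \<cdot> z2" using regular_epi_lift[OF e(2,1) comp_closed[OF 1(1) pH(2)]] .
    obtain Z3 z3 t3 where 3: "z3 \<in> Hom C Z3 Z2" "is_regular_epi C z3" "t3 \<in> Hom C Z3 T"
      "c \<cdot> t3 = d \<cdot> ((t1 \<cdot> z2) \<cdot> z3)" "d \<cdot> t3 = c \<cdot> ((t1 \<cdot> z2) \<cdot> z3)"
      using symm[OF comp_closed[OF 2(1) 1(3)]] by blast
    note [simp] = HomD[OF 1(1)] HomD[OF 1(3)] HomD[OF 2(1)] HomD[OF 2(3)] HomD[OF 3(1)] HomD[OF 3(3)]
    have ct1: "c \<cdot> (t1 \<cdot> w) = d0 \<cdot> (p \<cdot> (z1 \<cdot> w))" "d \<cdot> (t1 \<cdot> w) = d1 \<cdot> (p \<cdot> (z1 \<cdot> w))"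
      if "w \<in> Hom C W Z1" for w W
      using comp_reassoc[OF d0e, of "t1 \<cdot> w"] comp_reassoc[OF d1e, of "t1 \<cdot> w"]
        comp_reassoc[OF 1(4), of w] HomD[OF that] by simp_all
    have ct2: "c \<cdot> (t2 \<cdot> w) = d0 \<cdot> (q \<cdot> (z1 \<cdot> (z2 \<cdot> w)))" "d \<cdot> (t2 \<cdot> w) = d1 \<cdot> (q \<cdot> (z1 \<cdot> (z2 \<cdot> w)))"
      if "w \<in> Hom C W Z2" for w W
      using comp_reassoc[OF d0e, of "t2 \<cdot> w"] comp_reassoc[OF d1e, of "t2 \<cdot> w"]
        comp_reassoc[OF 2(4), of w] HomD[OF that] by simp_all
    have zH: "z3 \<in> Hom C Z3 Z2" "z2 \<cdot> z3 \<in> Hom C Z3 Z1" by (simp_all add: Hom_iff)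
    have "c \<cdot> t3 = c \<cdot> (t2 \<cdot> z3)"
      using 3(4) ct1(2)[OF zH(2)] ct2(1)[OF zH(1)]
        comp_reassoc[OF is_pullbackD(9)[OF pq], of "z1 \<cdot> (z2 \<cdot> z3)"] by simp
    from euclid[OF 3(3) comp_closed[OF 3(1) 2(3)] this]
    obtain Z4 z4 t4 where 4: "z4 \<in> Hom C Z4 Z3" "is_regular_epi C z4" "t4 \<in> Hom C Z4 T"
      "c \<cdot> t4 = d \<cdot> (t3 \<cdot> z4)" "d \<cdot> t4 = d \<cdot> ((t2 \<cdot> z3) \<cdot> z4)" by blast
    note [simp] = HomD[OF 4(1)] HomD[OF 4(3)]
    have z34: "z3 \<cdot> z4 \<in> Hom C Z4 Z2" "z2 \<cdot> (z3 \<cdot> z4) \<in> Hom C Z4 Z1"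
      "z1 \<cdot> (z2 \<cdot> (z3 \<cdot> z4)) \<in> Hom C Z4 (dom C p)" by (simp_all add: Hom_iff)
    show ?thesis
    proof (rule factor[OF z34(3) _ _ _ 4(3)])
      show "is_regular_epi C (z1 \<cdot> (z2 \<cdot> (z3 \<cdot> z4)))"
        using regular_epi_comp[OF regular_epi_comp[OF regular_epi_comp[OF 4(2) 3(2) 4(1) 3(1)]
              2(2) z34(1) 2(1)] 1(2) z34(2) 1(1)] .
      show "c \<cdot> t4 = (d0 \<cdot> p) \<cdot> (z1 \<cdot> (z2 \<cdot> (z3 \<cdot> z4)))"
        using 4(4) comp_reassoc[OF 3(5), of z4] ct1(1)[OF z34(2)] by simp
      show "d \<cdot> t4 = (d1 \<cdot> q) \<cdot> (z1 \<cdot> (z2 \<cdot> (z3 \<cdot> z4)))"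
        using 4(5) ct2(2)[OF z34(1)] by simp
    qed (simp_all add: Hom_iff)
  qed
  have "is_equivalence_relation C R X d0 d1"
    unfolding is_equivalence_relation_def using dH joint refl sym pq trans by blast
  then obtain q where q: "is_pullback C q q d0 d1"
    using effective unfolding is_kernel_pair_def by blast
  have qH: "q \<in> Hom C X (cod C q)" using is_pullbackD[OF q] by (simp add: Hom_iff)
  note [simp] = HomD[OF qH]
  have qcd: "q \<cdot> c = q \<cdot> d"
    using comp_reassoc[OF is_pullbackD(9)[OF q], of e] d0e d1e by simp
  show thesis
  proof (rule that[OF qH qcd])
    fix Z x y
    assume x: "x \<in> Hom C Z X" and y: "y \<in> Hom C Z X" and xy: "q \<cdot> x = q \<cdot> y"
    obtain h where h: "h \<in> Hom C Z R" "d0 \<cdot> h = x" "d1 \<cdot> h = y"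
      using pullback_lift[OF q, of x Z y] x y xy by auto
    obtain Z' z t where z: "z \<in> Hom C Z' Z" "is_regular_epi C z" "t \<in> Hom C Z' T" "e \<cdot> t = h \<cdot> z"
      using regular_epi_lift[OF e(2,1) h(1)] .
    note [simp] = HomD[OF x] HomD[OF y] HomD[OF h(1)] HomD[OF z(1)] HomD[OF z(3)]
    have "c \<cdot> t = x \<cdot> z" "d \<cdot> t = y \<cdot> z"
      using comp_reassoc[OF d0e, of t] comp_reassoc[OF d1e, of t]
        comp_reassoc[OF h(2), of z] comp_reassoc[OF h(3), of z] z(4) by simp_all
    then show "\<exists>Z' z t. z \<in> Hom C Z' Z \<and> is_regular_epi C z \<and> t \<in> Hom C Z' T \<and> c \<cdot> t = x \<cdot> z \<and> d \<cdot> t = y \<cdot> z"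
      using z by blast
  qed
qed


section \<open>Amalgamation of monomorphisms\<close>

text \<open>
  For sets, the four summands describe the pairs \<open>(x, y)\<close> with \<open>[1, m] x = [1, m] y\<close>:
  equal ones, \<open>(m s, s)\<close>, \<open>(s, m s)\<close> and \<open>(s, s)\<close>.
\<close>

lemma mono_cotuple_kernel_cover:
  assumes m: "m \<in> Hom C S A" "is_mono C m"
    and x: "x \<in> Hom C Z (coprod A S)" and y: "y \<in> Hom C Z (coprod A S)"
    and eq: "\<lbrace>ident C A, m\<rbrace> \<cdot> x = \<lbrace>ident C A, m\<rbrace> \<cdot> y"
  obtains Z' z w where "z \<in> Hom C Z' Z" "is_regular_epi C z"
    "w \<in> Hom C Z' (coprod (coprod A S) (coprod S S))"
    "\<lbrace>ident C (coprod A S), m \<oplus> ident C S\<rbrace> \<cdot> w = x \<cdot> z"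
    "(\<lbrace>ident C A, m\<rbrace> \<oplus> \<lbrace>ident C S, ident C S\<rbrace>) \<cdot> w = y \<cdot> z"
proof -
  note [simp] = HomD[OF m(1)]
  have p: "\<lbrace>ident C A, m\<rbrace> \<in> Hom C (coprod A S) A" by (simp add: Hom_iff)
  have "is_regular_epi C \<lbrace>ident C A, m\<rbrace>"
    by (rule split_epi_regular[OF p, of "inl A S"]) (simp_all add: Hom_iff)
  \<comment> \<open>Here \<open>y\<close> is split over the summands of \<open>A + S\<close>:
    pulling [1, m] back along the identity gives \<open>A + S\<close>, and along \<open>m\<close>
    gives \<open>S + S\<close> by (c).\<close>
  note cover = regular_epi_pullback_coprod_cover[OF p this pullback_ident[OF p]
      pullback_sym[OF mono_square_pullback[OF m]], of y Z x]
  show thesis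
    by (rule cover) (use x y eq that in \<open>simp_all add: coprod_map_def\<close>)
qed

text \<open>
  For sets, the image of \<open>(c, d)\<close> is the equivalence relation on \<open>A + B\<close> that identifies
  \<open>m s\<close> with \<open>n s\<close>.
\<close>

lemma mono_span_quotient:
  assumes m: "m \<in> Hom C S A" "is_mono C m" and n: "n \<in> Hom C S B" "is_mono C n"
  defines "c \<equiv> \<lbrace>ident C A, m\<rbrace> \<oplus> \<lbrace>ident C B, n\<rbrace>"
    and "d \<equiv> \<lbrace>\<lbrace>inl A B, inr A B \<cdot> n\<rbrace>, \<lbrace>inr A B, inl A B \<cdot> m\<rbrace>\<rbrace>"
  obtains Q q where "q \<in> Hom C (coprod A B) Q" "q \<cdot> (inl A B \<cdot> m) = q \<cdot> (inr A B \<cdot> n)"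
    "\<And>Z x y. x \<in> Hom C Z (coprod A B) \<Longrightarrow> y \<in> Hom C Z (coprod A B) \<Longrightarrow> q \<cdot> x = q \<cdot> y \<Longrightarrow>
      \<exists>Z' z t. z \<in> Hom C Z' Z \<and> is_regular_epi C z \<and>
        t \<in> Hom C Z' (coprod (coprod A S) (coprod B S)) \<and> c \<cdot> t = x \<cdot> z \<and> d \<cdot> t = y \<cdot> z"
proof -
  note [simp] = HomD[OF m(1)] HomD[OF n(1)]
  let ?T = "coprod (coprod A S) (coprod B S)"
  let ?p1 = "\<lbrace>ident C A, m\<rbrace>" and ?p2 = "\<lbrace>ident C B, n\<rbrace>"
  define \<delta>1 where "\<delta>1 = \<lbrace>inl A B, inr A B \<cdot> n\<rbrace>"
  define \<delta>2 where "\<delta>2 = \<lbrace>inr A B, inl A B \<cdot> m\<rbrace>"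
  have cH: "c \<in> Hom C ?T (coprod A B)" and dH: "d \<in> Hom C ?T (coprod A B)"
    and \<delta>H: "\<delta>1 \<in> Hom C (coprod A S) (coprod A B)" "\<delta>2 \<in> Hom C (coprod B S) (coprod A B)"
    by (simp_all add: c_def d_def \<delta>1_def \<delta>2_def coprod_map_def Hom_iff)
  have d_\<delta>: "d = \<lbrace>\<delta>1, \<delta>2\<rbrace>" by (simp add: d_def \<delta>1_def \<delta>2_def)
  have \<rho>: "inl A S \<oplus> inl B S \<in> Hom C (coprod A B) ?T"
    "c \<cdot> (inl A S \<oplus> inl B S) = ident C (coprod A B)"
    "d \<cdot> (inl A S \<oplus> inl B S) = ident C (coprod A B)"
    by (simp_all add: c_def d_def coprod_map_def Hom_iff)
  have euclid: "\<exists>Z' z t. z \<in> Hom C Z' Z \<and> is_regular_epi C z \<and> t \<in> Hom C Z' ?T \<and>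
      c \<cdot> t = d \<cdot> (x \<cdot> z) \<and> d \<cdot> t = d \<cdot> (y \<cdot> z)"
    if x: "x \<in> Hom C Z ?T" and y: "y \<in> Hom C Z ?T" and xy: "c \<cdot> x = c \<cdot> y" for Z x y
  proof -
    have pH: "?p1 \<in> Hom C (coprod A S) A" "?p2 \<in> Hom C (coprod B S) B" by (simp_all add: Hom_iff)
    obtain a1 b1 where pb1: "is_pullback C ?p1 ?p1 a1 b1" using pullback_exists[OF pH(1,1)] .
    obtain a2 b2 where pb2: "is_pullback C ?p2 ?p2 a2 b2" using pullback_exists[OF pH(2,2)] .
    have abH: "a1 \<in> Hom C (dom C a1) (coprod A S)" "b1 \<in> Hom C (dom C a1) (coprod A S)"
      "a2 \<in> Hom C (dom C a2) (coprod B S)" "b2 \<in> Hom C (dom C a2) (coprod B S)"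
      using is_pullbackD[OF pb1] is_pullbackD[OF pb2] by (simp_all add: Hom_iff)
    note [simp] = HomD(1,3-5)[OF abH(1)] HomD[OF abH(2)] HomD(1,3-5)[OF abH(3)] HomD[OF abH(4)]
    \<comment> \<open>By (b) the kernel pair of \<open>c\<close> splits into those of [1, m] and
      [1, n], whose covers are known.\<close>
    have pb: "is_pullback C c c (a1 \<oplus> a2) (b1 \<oplus> b2)"
      unfolding c_def by (rule pullback_coprod_map[OF pb1 pb2])
    obtain w0 where w0: "w0 \<in> Hom C Z (dom C (a1 \<oplus> a2))" "(a1 \<oplus> a2) \<cdot> w0 = x" "(b1 \<oplus> b2) \<cdot> w0 = y"
      by (rule pullback_lift[OF pb, of x Z y]) (use x y xy HomD[OF cH] in simp_all)
    have w0H: "w0 \<in> Hom C Z (coprod (dom C a1) (dom C a2))" using w0(1) by (simp add: coprod_map_def)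
    obtain Z1 z1 w1 where z1: "z1 \<in> Hom C Z1 (dom C a1)" "is_regular_epi C z1"
      and w1: "w1 \<in> Hom C Z1 (coprod (coprod A S) (coprod S S))"
      "\<lbrace>ident C (coprod A S), m \<oplus> ident C S\<rbrace> \<cdot> w1 = a1 \<cdot> z1"
      "(\<lbrace>ident C A, m\<rbrace> \<oplus> \<lbrace>ident C S, ident C S\<rbrace>) \<cdot> w1 = b1 \<cdot> z1"
      using mono_cotuple_kernel_cover[OF m abH(1,2) is_pullbackD(9)[OF pb1]] .
    obtain Z2 z2 w2 where z2: "z2 \<in> Hom C Z2 (dom C a2)" "is_regular_epi C z2"
      and w2: "w2 \<in> Hom C Z2 (coprod (coprod B S) (coprod S S))"
      "\<lbrace>ident C (coprod B S), n \<oplus> ident C S\<rbrace> \<cdot> w2 = a2 \<cdot> z2"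
      "(\<lbrace>ident C B, n\<rbrace> \<oplus> \<lbrace>ident C S, ident C S\<rbrace>) \<cdot> w2 = b2 \<cdot> z2"
      using mono_cotuple_kernel_cover[OF n abH(3,4) is_pullbackD(9)[OF pb2]] .
    note [simp] = HomD[OF z1(1)] HomD[OF w1(1)] HomD[OF z2(1)] HomD[OF w2(1)] HomD[OF w0H]
      HomD[OF x] HomD[OF y]
    define i where "i = inl (coprod A S) (coprod B S)"
    define j where "j = inr (coprod A S) (coprod B S)"
    \<comment> \<open>The four entries answer the pairs (a, a), (s, m s), (m s, s), (s, s) in the
      kernel pair of [1, m]. After \<open>\<delta>1\<close> they become (a, a), (n s, m s), (m s, n
      s), (n s, n s), and each is an instance of a loop or of a generating pair. For
      \<open>t2\<close> the two sides are exchanged.\<close>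
    define t1 where "t1 = \<lbrace>\<lbrace>i \<cdot> inl A S, j \<cdot> inr B S\<rbrace>, \<lbrace>i \<cdot> inr A S, j \<cdot> (inl B S \<cdot> n)\<rbrace>\<rbrace> \<cdot> w1"
    define t2 where "t2 = \<lbrace>\<lbrace>j \<cdot> inl B S, i \<cdot> inr A S\<rbrace>, \<lbrace>j \<cdot> inr B S, i \<cdot> (inl A S \<cdot> m)\<rbrace>\<rbrace> \<cdot> w2"
    have tH: "t1 \<in> Hom C Z1 ?T" "t2 \<in> Hom C Z2 ?T"
      by (simp_all add: t1_def t2_def i_def j_def Hom_iff)
    have t1: "c \<cdot> t1 = \<delta>1 \<cdot> (a1 \<cdot> z1)" "d \<cdot> t1 = \<delta>1 \<cdot> (b1 \<cdot> z1)"
      unfolding w1(2,3)[symmetric]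
      by (simp_all add: t1_def c_def d_def \<delta>1_def i_def j_def coprod_map_def)
    have t2: "c \<cdot> t2 = \<delta>2 \<cdot> (a2 \<cdot> z2)" "d \<cdot> t2 = \<delta>2 \<cdot> (b2 \<cdot> z2)"
      unfolding w2(2,3)[symmetric]
      by (simp_all add: t2_def c_def d_def \<delta>2_def i_def j_def coprod_map_def)
    have zz: "z1 \<oplus> z2 \<in> Hom C (coprod Z1 Z2) (coprod (dom C a1) (dom C a2))"
      by (simp add: coprod_map_def Hom_iff)
    obtain Z' z w where z: "z \<in> Hom C Z' Z" "is_regular_epi C z" and w: "w \<in> Hom C Z' (coprod Z1 Z2)"
      "(z1 \<oplus> z2) \<cdot> w = w0 \<cdot> z"
      using regular_epi_lift[OF coprod_map_regular_epi[OF z1(2) z2(2)] zz w0H] .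
    note [simp] = HomD[OF z(1)] HomD[OF w(1)] HomD[OF tH(1)] HomD[OF tH(2)]
      HomD[OF cH] HomD[OF \<delta>H(1)] HomD[OF \<delta>H(2)]
    have "x \<cdot> z = (a1 \<oplus> a2) \<cdot> ((z1 \<oplus> z2) \<cdot> w)" "y \<cdot> z = (b1 \<oplus> b2) \<cdot> ((z1 \<oplus> z2) \<cdot> w)"
      using comp_reassoc[OF w0(2), of z] comp_reassoc[OF w0(3), of z] w(2)
      by (simp_all add: coprod_map_def)
    then have "d \<cdot> (x \<cdot> z) = \<lbrace>\<delta>1 \<cdot> (a1 \<cdot> z1), \<delta>2 \<cdot> (a2 \<cdot> z2)\<rbrace> \<cdot> w"
      "d \<cdot> (y \<cdot> z) = \<lbrace>\<delta>1 \<cdot> (b1 \<cdot> z1), \<delta>2 \<cdot> (b2 \<cdot> z2)\<rbrace> \<cdot> w"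
      by (simp_all add: d_\<delta> coprod_map_def)
    moreover have "c \<cdot> (\<lbrace>t1, t2\<rbrace> \<cdot> w) = \<lbrace>c \<cdot> t1, c \<cdot> t2\<rbrace> \<cdot> w"
      "d \<cdot> (\<lbrace>t1, t2\<rbrace> \<cdot> w) = \<lbrace>d \<cdot> t1, d \<cdot> t2\<rbrace> \<cdot> w"
      using HomD[OF dH] by simp_all
    moreover have "\<lbrace>t1, t2\<rbrace> \<cdot> w \<in> Hom C Z' ?T" by (simp add: Hom_iff)
    ultimately show ?thesis using z t1 t2 by metis
  qed
  obtain Q q where q: "q \<in> Hom C (coprod A B) Q" "q \<cdot> c = q \<cdot> d"
    and cover: "\<And>Z x y. x \<in> Hom C Z (coprod A B) \<Longrightarrow> y \<in> Hom C Z (coprod A B) \<Longrightarrow> q \<cdot> x = q \<cdot> y \<Longrightarrow>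
      \<exists>Z' z t. z \<in> Hom C Z' Z \<and> is_regular_epi C z \<and> t \<in> Hom C Z' ?T \<and> c \<cdot> t = x \<cdot> z \<and> d \<cdot> t = y \<cdot> z"
    by (rule euclidean_quotient[OF cH dH \<rho>]) (erule (2) euclid, rule that)
  note [simp] = HomD[OF q(1)]
  \<comment> \<open>On this summand \<open>c\<close> and \<open>d\<close> are the two arrows that
    \<open>q\<close> has to identify.\<close>
  define k where "k = inl (coprod A S) (coprod B S) \<cdot> inr A S"
  have "k \<in> Hom C S ?T" by (simp add: k_def Hom_iff)
  then have "q \<cdot> (c \<cdot> k) = q \<cdot> (d \<cdot> k)"
    using comp_reassoc[OF q(2), of k] HomD[OF cH] HomD[OF dH] HomD[of k S ?T] by simp
  then have "q \<cdot> (inl A B \<cdot> m) = q \<cdot> (inr A B \<cdot> n)"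
    by (simp add: c_def d_def k_def coprod_map_def)
  then show thesis using that[OF q(1) _ cover] by blast
qed

text \<open>Anything related to an element of \<open>B\<close> lies in \<open>S + B\<close>. There
  the relation is respected by [n, 1] into \<open>B\<close>, which is the identity on
  \<open>B\<close>, so related elements of \<open>B\<close> are equal.\<close>

lemma mono_amalgamation:
  assumes m: "m \<in> Hom C S A" "is_mono C m" and n: "n \<in> Hom C S B" "is_mono C n"
  obtains Q u v where "u \<in> Hom C A Q" "v \<in> Hom C B Q" "u \<cdot> m = v \<cdot> n" "is_mono C v"
proof -
  note [simp] = HomD[OF m(1)] HomD[OF n(1)]
  let ?c = "\<lbrace>ident C A, m\<rbrace> \<oplus> \<lbrace>ident C B, n\<rbrace>"
  let ?d = "\<lbrace>\<lbrace>inl A B, inr A B \<cdot> n\<rbrace>, \<lbrace>inr A B, inl A B \<cdot> m\<rbrace>\<rbrace>"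
  obtain Q q where q: "q \<in> Hom C (coprod A B) Q" "q \<cdot> (inl A B \<cdot> m) = q \<cdot> (inr A B \<cdot> n)"
    and cover: "\<And>Z x y. x \<in> Hom C Z (coprod A B) \<Longrightarrow> y \<in> Hom C Z (coprod A B) \<Longrightarrow> q \<cdot> x = q \<cdot> y \<Longrightarrow>
      \<exists>Z' z t. z \<in> Hom C Z' Z \<and> is_regular_epi C z \<and>
        t \<in> Hom C Z' (coprod (coprod A S) (coprod B S)) \<and> ?c \<cdot> t = x \<cdot> z \<and> ?d \<cdot> t = y \<cdot> z"
    by (rule mono_span_quotient[OF m n]) (rule that)
  note [simp] = HomD[OF q(1)]
  have vH: "q \<cdot> inr A B \<in> Hom C B Q" by (simp add: Hom_iff)
  have "is_mono C (q \<cdot> inr A B)"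
  proof (rule is_monoI[OF vH])
    fix Z b b'
    assume b: "b \<in> Hom C Z B" and b': "b' \<in> Hom C Z B" and eq: "q \<cdot> inr A B \<cdot> b = q \<cdot> inr A B \<cdot> b'"
    note [simp] = HomD[OF b] HomD[OF b']
    have "inr A B \<cdot> b \<in> Hom C Z (coprod A B)" "inr A B \<cdot> b' \<in> Hom C Z (coprod A B)"
      "q \<cdot> (inr A B \<cdot> b) = q \<cdot> (inr A B \<cdot> b')"
      using eq by (simp_all add: Hom_iff)
    from cover[OF this] obtain Z' z t where z: "z \<in> Hom C Z' Z" "is_regular_epi C z"
      and t: "t \<in> Hom C Z' (coprod (coprod A S) (coprod B S))"
      "?c \<cdot> t = inr A B \<cdot> b \<cdot> z" "?d \<cdot> t = inr A B \<cdot> b' \<cdot> z" by blast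
    note [simp] = HomD[OF z(1)] HomD[OF t(1)]
    have "\<lbrace>ident C B, n\<rbrace> \<in> Hom C (coprod B S) B" by (simp add: Hom_iff)
    \<comment> \<open>The inverse image of \<open>S + B\<close> under \<open>?c\<close> is
      \<open>(S + S) + (B + S)\<close>, and \<open>t\<close> lies in it.\<close>
    note pb = pullback_coprod_map[OF mono_square_pullback[OF m]
        pullback_sym[OF pullback_ident[OF this]]]
    obtain t' where t': "t' \<in> Hom C Z' (dom C (\<lbrace>ident C S, ident C S\<rbrace> \<oplus> \<lbrace>ident C B, n\<rbrace>))"
      "(\<lbrace>ident C S, ident C S\<rbrace> \<oplus> \<lbrace>ident C B, n\<rbrace>) \<cdot> t' = inr S B \<cdot> (b \<cdot> z)"
      "((m \<oplus> ident C S) \<oplus> ident C (coprod B S)) \<cdot> t' = t"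
      by (rule pullback_lift[OF pb, of "inr S B \<cdot> (b \<cdot> z)" Z' t])
        (use t(2) in \<open>simp_all add: Hom_iff coprod_map_def\<close>)
    have "t' \<in> Hom C Z' (coprod (coprod S S) (coprod B S))"
      using t'(1) by (simp add: coprod_map_def)
    note [simp] = HomD[OF this]
    \<comment> \<open>The restriction of \<open>?d\<close> to that inverse image, which lands in
      \<open>S + B\<close>.\<close>
    let ?d' = "\<lbrace>\<lbrace>inl S B, inr S B \<cdot> n\<rbrace>, \<lbrace>inr S B, inl S B\<rbrace>\<rbrace>"
    have "(m \<oplus> ident C B) \<cdot> (?d' \<cdot> t') = ?d \<cdot> (((m \<oplus> ident C S) \<oplus> ident C (coprod B S)) \<cdot> t')"
      by (simp add: coprod_map_def)
    also have "\<dots> = (m \<oplus> ident C B) \<cdot> (inr S B \<cdot> (b' \<cdot> z))"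
      unfolding t'(3) t(3) by (simp add: coprod_map_def)
    finally have eq': "?d' \<cdot> t' = inr S B \<cdot> (b' \<cdot> z)"
      using is_monoD[OF coprod_map_mono[OF m(2), of "ident C B"], of "?d' \<cdot> t'" Z' "inr S B \<cdot> (b' \<cdot> z)"]
        is_monoI[of "ident C B" B B]
      by (simp add: coprod_map_def Hom_iff)
    \<comment> \<open>The arrow [n, 1] has equal composites with the restrictions of
      \<open>?c\<close> and \<open>?d\<close>.\<close>
    have "b \<cdot> z = \<lbrace>n, ident C B\<rbrace> \<cdot> (inr S B \<cdot> (b \<cdot> z))" by simp
    also have "\<dots> = \<lbrace>n, ident C B\<rbrace> \<cdot> (?d' \<cdot> t')"
      unfolding t'(2)[symmetric] by (simp add: coprod_map_def)
    also have "\<dots> = b' \<cdot> z" unfolding eq' by simp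
    finally show "b = b'" using regular_epi_cancel[OF z(2), of b B b'] by (simp add: Hom_iff)
  qed
  moreover have "q \<cdot> inl A B \<in> Hom C A Q" "q \<cdot> inl A B \<cdot> m = q \<cdot> inr A B \<cdot> n"
    using q(2) by (simp_all add: Hom_iff)
  ultimately show thesis using that vH by blast
qed

text \<open>Glue two copies of \<open>A\<close> along \<open>S\<close>. Anything related to the left
  copy lies in \<open>A + S\<close>, so an element whose two copies are related belongs to
  \<open>S\<close>.\<close>

lemma mono_is_equalizer:
  assumes m: "m \<in> Hom C S A" "is_mono C m"
  obtains Q u v where "u \<in> Hom C A Q" "v \<in> Hom C A Q" "u \<cdot> m = v \<cdot> m"
    "\<And>Z x. x \<in> Hom C Z A \<Longrightarrow> u \<cdot> x = v \<cdot> x \<Longrightarrow> \<exists>k \<in> Hom C Z S. m \<cdot> k = x"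
proof -
  note [simp] = HomD[OF m(1)]
  let ?p = "\<lbrace>ident C A, m\<rbrace>"
  let ?c = "?p \<oplus> ?p"
  let ?d = "\<lbrace>\<lbrace>inl A A, inr A A \<cdot> m\<rbrace>, \<lbrace>inr A A, inl A A \<cdot> m\<rbrace>\<rbrace>"
  obtain Q q where q: "q \<in> Hom C (coprod A A) Q" "q \<cdot> (inl A A \<cdot> m) = q \<cdot> (inr A A \<cdot> m)"
    and cover: "\<And>Z x y. x \<in> Hom C Z (coprod A A) \<Longrightarrow> y \<in> Hom C Z (coprod A A) \<Longrightarrow> q \<cdot> x = q \<cdot> y \<Longrightarrow>
      \<exists>Z' z t. z \<in> Hom C Z' Z \<and> is_regular_epi C z \<and>
        t \<in> Hom C Z' (coprod (coprod A S) (coprod A S)) \<and> ?c \<cdot> t = x \<cdot> z \<and> ?d \<cdot> t = y \<cdot> z"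
    by (rule mono_span_quotient[OF m m]) (rule that)
  note [simp] = HomD[OF q(1)]
  have uvH: "q \<cdot> inl A A \<in> Hom C A Q" "q \<cdot> inr A A \<in> Hom C A Q" by (simp_all add: Hom_iff)
  have comm: "q \<cdot> inl A A \<cdot> m = q \<cdot> inr A A \<cdot> m" using q(2) by simp
  show thesis
  proof (rule that[OF uvH comm])
    fix Z x
    assume x: "x \<in> Hom C Z A" and eq: "q \<cdot> inl A A \<cdot> x = q \<cdot> inr A A \<cdot> x"
    note [simp] = HomD[OF x]
    have "inl A A \<cdot> x \<in> Hom C Z (coprod A A)" "inr A A \<cdot> x \<in> Hom C Z (coprod A A)"
      "q \<cdot> (inl A A \<cdot> x) = q \<cdot> (inr A A \<cdot> x)"
      using eq by (simp_all add: Hom_iff)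
    from cover[OF this] obtain Z' z t where z: "z \<in> Hom C Z' Z" "is_regular_epi C z"
      and t: "t \<in> Hom C Z' (coprod (coprod A S) (coprod A S))"
      "?c \<cdot> t = inl A A \<cdot> x \<cdot> z" "?d \<cdot> t = inr A A \<cdot> x \<cdot> z" by blast
    note [simp] = HomD[OF z(1)] HomD[OF t(1)]
    have "?p \<in> Hom C (coprod A S) A" by (simp add: Hom_iff)
    \<comment> \<open>The inverse image of \<open>A + S\<close> under \<open>?c\<close> is
      \<open>(A + S) + (S + S)\<close>; on it \<open>?d\<close> lands in \<open>A + S\<close>, as
      \<open>?d'\<close> records.\<close>
    note pb = pullback_coprod_map[OF pullback_sym[OF pullback_ident[OF this]]
        mono_square_pullback[OF m]]
    obtain t' where t': "t' \<in> Hom C Z' (dom C (?p \<oplus> \<lbrace>ident C S, ident C S\<rbrace>))"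
      "(?p \<oplus> \<lbrace>ident C S, ident C S\<rbrace>) \<cdot> t' = inl A S \<cdot> (x \<cdot> z)"
      "(ident C (coprod A S) \<oplus> (m \<oplus> ident C S)) \<cdot> t' = t"
      by (rule pullback_lift[OF pb, of "inl A S \<cdot> (x \<cdot> z)" Z' t])
        (use t(2) in \<open>simp_all add: Hom_iff coprod_map_def\<close>)
    have "t' \<in> Hom C Z' (coprod (coprod A S) (coprod S S))"
      using t'(1) by (simp add: coprod_map_def)
    note [simp] = HomD[OF this]
    let ?d' = "\<lbrace>\<lbrace>inl A S, inr A S\<rbrace>, \<lbrace>inr A S, inl A S \<cdot> m\<rbrace>\<rbrace>"
    have "inr A A \<cdot> (x \<cdot> z) = ?d \<cdot> ((ident C (coprod A S) \<oplus> (m \<oplus> ident C S)) \<cdot> t')"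
      unfolding t'(3) t(3) by simp
    also have "\<dots> = (ident C A \<oplus> m) \<cdot> (?d' \<cdot> t')"
      by (simp add: coprod_map_def del: cotuple_inl_inr)
    finally obtain s where s: "s \<in> Hom C Z' S" "m \<cdot> s = x \<cdot> z"
      using inr_factor[OF m(1), of A "x \<cdot> z" Z' "?d' \<cdot> t'"] by (auto simp: Hom_iff)
    obtain k where "k \<in> Hom C (cod C z) (dom C m)" "x = m \<cdot> k"
      by (rule regular_epi_factor_mono[OF z(2) m(2), of x A s]) (use s x in simp_all)
    then show "\<exists>k \<in> Hom C Z S. m \<cdot> k = x" by (intro bexI[of _ k]) simp_all
  qed
qed

text \<open>A monomorphism through which an epimorphism factors is the equalizer of two arrows that
  the epimorphism forces to be equal, so the identity factors through it.\<close>

lemma epi_regular: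
  assumes f: "f \<in> Hom C X Y"
    and epi: "\<And>Z g h. g \<in> Hom C Y Z \<Longrightarrow> h \<in> Hom C Y Z \<Longrightarrow> g \<cdot> f = h \<cdot> f \<Longrightarrow> g = h"
  shows "is_regular_epi C f"
proof (rule regular_epi_of_strong_epi[OF f])
  fix I e n
  assume e: "e \<in> Hom C X I" and n: "n \<in> Hom C I Y" and mono: "is_mono C n" and fne: "f = n \<cdot> e"
  obtain Q u v where uv: "u \<in> Hom C Y Q" "v \<in> Hom C Y Q" "u \<cdot> n = v \<cdot> n"
    and factor: "\<And>Z x. x \<in> Hom C Z Y \<Longrightarrow> u \<cdot> x = v \<cdot> x \<Longrightarrow> \<exists>k \<in> Hom C Z I. n \<cdot> k = x"
    by (rule mono_is_equalizer[OF n mono]) (rule that)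
  have "u \<cdot> f = v \<cdot> f"
    unfolding fne using comp_assoc[OF e n uv(1)] comp_assoc[OF e n uv(2)] uv(3) by simp
  then have "u = v" using epi uv by blast
  then show "\<exists>k \<in> Hom C Y I. n \<cdot> k = ident C Y"
    using factor ident_closed HomD(5)[OF f] by blast
qed

text \<open>
  For sets, the image of \<open>[1, m k1], [1, m k2] : A + K \<rightarrow> A\<close> identifies \<open>m s\<close> with \<open>m s'\<close>
  whenever \<open>p s = p s'\<close>.
\<close>

lemma mono_regular_epi_amalgamation:
  assumes m: "m \<in> Hom C S A" "is_mono C m" and p: "p \<in> Hom C S B" "is_regular_epi C p"
  obtains Q u v where "u \<in> Hom C A Q" "v \<in> Hom C B Q" "u \<cdot> m = v \<cdot> p" "is_mono C v"
proof -
  note [simp] = HomD[OF m(1)] HomD[OF p(1)]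
  obtain k1 k2 where pb: "is_pullback C p p k1 k2" using pullback_exists[OF p(1,1)] .
  define K where "K = dom C k1"
  have kH: "k1 \<in> Hom C K S" "k2 \<in> Hom C K S"
    using is_pullbackD[OF pb] by (simp_all add: K_def Hom_iff)
  note [simp] = HomD[OF kH(1)] HomD[OF kH(2)]
  have pk: "p \<cdot> k1 = p \<cdot> k2" using is_pullbackD(9)[OF pb] .
  have klift: "\<exists>h \<in> Hom C Z K. k1 \<cdot> h = x \<and> k2 \<cdot> h = y"
    if "x \<in> Hom C Z S" "y \<in> Hom C Z S" "p \<cdot> x = p \<cdot> y" for Z x y
    using pullback_lift[OF pb, of x Z y] that by (metis HomD(2) kH(1) p(1))
  have idS: "ident C S \<in> Hom C S S" by (simp add: Hom_iff)
  obtain \<delta> where \<delta>: "\<delta> \<in> Hom C S K" "k1 \<cdot> \<delta> = ident C S" using klift[OF idS idS] by auto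
  have k1_reg: "is_regular_epi C k1" using split_epi_regular[OF kH(1) \<delta>] .
  obtain \<sigma> where \<sigma>: "\<sigma> \<in> Hom C K K" "k1 \<cdot> \<sigma> = k2" "k2 \<cdot> \<sigma> = k1"
    using klift[OF kH(2,1)] pk by auto
  note [simp] = HomD[OF \<sigma>(1)]
  define c where "c = \<lbrace>ident C A, m \<cdot> k1\<rbrace>"
  define d where "d = \<lbrace>ident C A, m \<cdot> k2\<rbrace>"
  have cdH: "c \<in> Hom C (coprod A K) A" "d \<in> Hom C (coprod A K) A"
    by (simp_all add: c_def d_def Hom_iff)
  have inlH: "inl A K \<in> Hom C A (coprod A K)" and c_inl: "c \<cdot> inl A K = ident C A"
    and d_inl: "d \<cdot> inl A K = ident C A" by (simp_all add: c_def d_def Hom_iff)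
  have c_reg: "is_regular_epi C c" using split_epi_regular[OF cdH(1) inlH c_inl] .
  have euclid: "\<exists>Z' z t. z \<in> Hom C Z' Z \<and> is_regular_epi C z \<and> t \<in> Hom C Z' (coprod A K) \<and>
      c \<cdot> t = d \<cdot> (x \<cdot> z) \<and> d \<cdot> t = d \<cdot> (y \<cdot> z)"
    if x: "x \<in> Hom C Z (coprod A K)" and y: "y \<in> Hom C Z (coprod A K)" and xy: "c \<cdot> x = c \<cdot> y"
    for Z x y
  proof -
    note [simp] = HomD[OF x] HomD[OF y]
    \<comment> \<open>Case analysis on the summand of \<open>y\<close>. The object \<open>P\<close>
      holds the pairs with \<open>y\<close> in \<open>K\<close>; it has to be split further
      according to the summand of \<open>x\<close>.\<close>
    obtain \<alpha> \<beta> where pb\<alpha>: "is_pullback C c (m \<cdot> k1) \<alpha> \<beta>"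
      using pullback_exists[OF cdH(1) comp_closed[OF kH(1) m(1)]] .
    define P where "P = dom C \<alpha>"
    have \<alpha>\<beta>: "\<alpha> \<in> Hom C P (coprod A K)" "\<beta> \<in> Hom C P K"
      using is_pullbackD[OF pb\<alpha>] HomD[OF cdH(1)] by (simp_all add: P_def Hom_iff)
    note [simp] = HomD[OF \<alpha>\<beta>(1)] HomD[OF \<alpha>\<beta>(2)]
    have eq: "m \<cdot> (k1 \<cdot> \<beta>) = \<lbrace>ident C A, m \<cdot> k1\<rbrace> \<cdot> \<alpha>"
      using is_pullbackD(9)[OF pb\<alpha>] by (simp add: c_def)
    obtain w where w: "w \<in> Hom C P (coprod S K)" "(m \<oplus> ident C K) \<cdot> w = \<alpha>"
      "\<lbrace>ident C S, k1\<rbrace> \<cdot> w = k1 \<cdot> \<beta>"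
      using mono_pullback_cotuple_through[OF m kH(1) \<alpha>\<beta>(1) comp_closed[OF \<alpha>\<beta>(2) kH(1)] eq] .
    obtain \<gamma>1 \<gamma>2 where pb\<gamma>: "is_pullback C k1 k1 \<gamma>1 \<gamma>2" using pullback_exists[OF kH(1,1)] .
    define J where "J = dom C \<gamma>1"
    have \<gamma>: "\<gamma>1 \<in> Hom C J K" "\<gamma>2 \<in> Hom C J K"
      using is_pullbackD[OF pb\<gamma>] by (simp_all add: J_def Hom_iff)
    note [simp] = HomD[OF w(1)] HomD[OF \<gamma>(1)] HomD[OF \<gamma>(2)]
    \<comment> \<open>On a cover of \<open>P\<close>, either \<open>\<alpha>\<close> is
      \<open>m \<cdot> (k1 \<cdot> \<beta>)\<close> in \<open>A\<close> (summand \<open>K\<close>),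
      or \<open>\<alpha>\<close> and \<open>\<beta>\<close> are two elements of \<open>K\<close>
      with the same \<open>k1\<close> (summand \<open>J\<close>).\<close>
    obtain P' z1 w1 where z1: "z1 \<in> Hom C P' P" "is_regular_epi C z1"
      and w1: "w1 \<in> Hom C P' (coprod K J)" "\<lbrace>ident C K, \<gamma>1\<rbrace> \<cdot> w1 = \<beta> \<cdot> z1" "(k1 \<oplus> \<gamma>2) \<cdot> w1 = w \<cdot> z1"
      by (rule regular_epi_pullback_coprod_cover[OF kH(1) k1_reg pullback_ident[OF kH(1)] pb\<gamma>, of w P \<beta>])
        (use w \<alpha>\<beta> in simp_all)
    note [simp] = HomD[OF z1(1)] HomD[OF w1(1)]
    have pkk: "p \<cdot> (k2 \<cdot> h) = p \<cdot> (k1 \<cdot> h)" if "h \<in> Hom C J K" for h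
      using comp_reassoc[OF pk, of h] HomD[OF that] by simp
    have "p \<cdot> (k2 \<cdot> \<gamma>2) = p \<cdot> (k2 \<cdot> \<gamma>1)"
      using pkk[OF \<gamma>(1)] pkk[OF \<gamma>(2)] is_pullbackD(9)[OF pb\<gamma>] by simp
    then obtain j where j: "j \<in> Hom C J K" "k1 \<cdot> j = k2 \<cdot> \<gamma>2" "k2 \<cdot> j = k2 \<cdot> \<gamma>1"
      using klift[OF comp_closed[OF \<gamma>(2) kH(2)] comp_closed[OF \<gamma>(1) kH(2)]] by auto
    note [simp] = HomD[OF j(1)]
    \<comment> \<open>The pair \<beta> itself answers the first case. In the second,
      \<open>j\<close> is the pair formed by the \<open>k2\<close> parts of \<open>\<gamma>2\<close>
      and \<open>\<gamma>1\<close>.\<close>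
    define tP where "tP = \<lbrace>inr A K, inr A K \<cdot> j\<rbrace> \<cdot> w1"
    have tPH: "tP \<in> Hom C P' (coprod A K)" by (simp add: tP_def Hom_iff)
    have \<alpha>z: "\<alpha> \<cdot> z1 = (m \<oplus> ident C K) \<cdot> ((k1 \<oplus> \<gamma>2) \<cdot> w1)"
      using comp_reassoc[OF w(2), of z1] w1(3) by (simp add: coprod_map_def)
    have tP: "c \<cdot> tP = d \<cdot> (\<alpha> \<cdot> z1)" "d \<cdot> tP = m \<cdot> (k2 \<cdot> (\<beta> \<cdot> z1))"
      unfolding \<alpha>z w1(2)[symmetric] by (simp_all add: tP_def c_def d_def j(2,3) coprod_map_def)
    obtain Z1 z w0 where z: "z \<in> Hom C Z1 Z" "is_regular_epi C z"
      and w0: "w0 \<in> Hom C Z1 (coprod (coprod A K) P)"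
      "\<lbrace>ident C (coprod A K), \<alpha>\<rbrace> \<cdot> w0 = x \<cdot> z" "(c \<oplus> \<beta>) \<cdot> w0 = y \<cdot> z"
    proof (rule regular_epi_pullback_coprod_cover[OF cdH(1) c_reg pullback_ident[OF cdH(1)] pb\<alpha>, of y Z x])
      show "c \<cdot> x = \<lbrace>ident C A, m \<cdot> k1\<rbrace> \<cdot> y" using xy by (simp add: c_def)
    qed (use x y in simp_all)
    have id_reg: "is_regular_epi C (ident C (coprod A K))"
      by (rule split_epi_regular[of _ "coprod A K" "coprod A K" "ident C (coprod A K)"])
        (simp_all add: Hom_iff)
    have "ident C (coprod A K) \<oplus> z1 \<in> Hom C (coprod (coprod A K) P') (coprod (coprod A K) P)"
      by (simp add: Hom_iff coprod_map_def)
    from regular_epi_lift[OF coprod_map_regular_epi[OF id_reg z1(2)] this w0(1)]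
    obtain Z' z' w' where z': "z' \<in> Hom C Z' Z1" "is_regular_epi C z'"
      and w': "w' \<in> Hom C Z' (coprod (coprod A K) P')" "(ident C (coprod A K) \<oplus> z1) \<cdot> w' = w0 \<cdot> z'" .
    note [simp] = HomD[OF z(1)] HomD[OF w0(1)] HomD[OF z'(1)] HomD[OF w'(1)] HomD[OF tPH]
      HomD[OF cdH(1)] HomD[OF cdH(2)]
    \<comment> \<open>For \<open>y\<close> in the summand \<open>A\<close> the value of
      \<open>y\<close> is \<open>c \<cdot> x\<close>, so reversing \<open>x\<close> by the swap
      \<sigma> of the kernel pair suffices.\<close>
    define t where "t = \<lbrace>ident C A \<oplus> \<sigma>, tP\<rbrace> \<cdot> w'"
    have "t \<in> Hom C Z' (coprod A K)" by (simp add: t_def coprod_map_def Hom_iff)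
    moreover have "c \<cdot> t = d \<cdot> (x \<cdot> (z \<cdot> z'))"
    proof -
      have "x \<cdot> (z \<cdot> z') = \<lbrace>ident C (coprod A K), \<alpha>\<rbrace> \<cdot> ((ident C (coprod A K) \<oplus> z1) \<cdot> w')"
        using comp_reassoc[OF w0(2), of z'] w'(2) by simp
      then have "d \<cdot> (x \<cdot> (z \<cdot> z')) = \<lbrace>d, d \<cdot> (\<alpha> \<cdot> z1)\<rbrace> \<cdot> w'" by (simp add: coprod_map_def)
      moreover have "c \<cdot> (ident C A \<oplus> \<sigma>) = d" by (simp add: c_def d_def coprod_map_def \<sigma>(2))
      then have "c \<cdot> t = \<lbrace>d, c \<cdot> tP\<rbrace> \<cdot> w'"
        by (simp add: t_def coprod_map_Arr dom_coprod_map cod_coprod_map)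
      ultimately show ?thesis by (simp add: tP)
    qed
    moreover have "d \<cdot> t = d \<cdot> (y \<cdot> (z \<cdot> z'))"
    proof -
      have "y \<cdot> (z \<cdot> z') = (c \<oplus> \<beta>) \<cdot> ((ident C (coprod A K) \<oplus> z1) \<cdot> w')"
        using comp_reassoc[OF w0(3), of z'] w'(2) by (simp add: coprod_map_def)
      moreover have "d \<cdot> (inl A K \<cdot> c) = c" "d \<cdot> (inr A K \<cdot> (\<beta> \<cdot> z1)) = m \<cdot> (k2 \<cdot> (\<beta> \<cdot> z1))"
        by (simp_all add: d_def)
      ultimately have "d \<cdot> (y \<cdot> (z \<cdot> z')) = \<lbrace>c, m \<cdot> (k2 \<cdot> (\<beta> \<cdot> z1))\<rbrace> \<cdot> w'"
        by (simp add: coprod_map_def)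
      moreover have "d \<cdot> (ident C A \<oplus> \<sigma>) = c" by (simp add: c_def d_def coprod_map_def \<sigma>(3))
      then have "d \<cdot> t = \<lbrace>c, d \<cdot> tP\<rbrace> \<cdot> w'"
        by (simp add: t_def coprod_map_Arr dom_coprod_map cod_coprod_map)
      ultimately show ?thesis by (simp add: tP)
    qed
    ultimately show ?thesis
      using comp_closed[OF z'(1) z(1)] regular_epi_comp[OF z'(2) z(2) z'(1) z(1)] by blast
  qed
  obtain Q q where q: "q \<in> Hom C A Q" "q \<cdot> c = q \<cdot> d"
    and cover: "\<And>Z x y. x \<in> Hom C Z A \<Longrightarrow> y \<in> Hom C Z A \<Longrightarrow> q \<cdot> x = q \<cdot> y \<Longrightarrow>
      \<exists>Z' z t. z \<in> Hom C Z' Z \<and> is_regular_epi C z \<and> t \<in> Hom C Z' (coprod A K) \<and>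
        c \<cdot> t = x \<cdot> z \<and> d \<cdot> t = y \<cdot> z"
    by (rule euclidean_quotient[OF cdH inlH c_inl d_inl]) (erule (2) euclid, rule that)
  note [simp] = HomD[OF q(1)]
  have "(q \<cdot> c) \<cdot> inr A K = (q \<cdot> d) \<cdot> inr A K" unfolding q(2) ..
  then have qmk: "q \<cdot> (m \<cdot> k1) = q \<cdot> (m \<cdot> k2)" by (simp add: c_def d_def)
  \<comment> \<open>Some pair has \<open>p\<close> as its coequalizer, and it factors through the
    kernel pair \<open>K\<close>; hence \<open>q \<cdot> m\<close> factors through
    \<open>p\<close>.\<close>
  obtain e1 e2 where coeq: "is_coequalizer C e1 e2 p" using p(2) unfolding is_regular_epi_def by blast
  have eH: "e1 \<in> Hom C (dom C e1) S" "e2 \<in> Hom C (dom C e1) S"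
    using is_coequalizerD[OF coeq] by (simp_all add: Hom_iff)
  obtain h where h: "h \<in> Hom C (dom C e1) K" "k1 \<cdot> h = e1" "k2 \<cdot> h = e2"
    using klift[OF eH is_coequalizerD(7)[OF coeq]] by blast
  have "(q \<cdot> m) \<cdot> (k1 \<cdot> h) = (q \<cdot> m) \<cdot> (k2 \<cdot> h)"
    using HomD(1,3)[OF h(1)] comp_reassoc[of q "m \<cdot> k1" "q \<cdot> (m \<cdot> k2)" h] qmk by simp
  then have "(q \<cdot> m) \<cdot> e1 = (q \<cdot> m) \<cdot> e2" unfolding h(2,3) .
  moreover have "q \<cdot> m \<in> Hom C (cod C e1) Q" using HomD(3)[OF eH(1)] by (simp add: Hom_iff)
  ultimately obtain v where "v \<in> Hom C (cod C p) Q" and vp: "v \<cdot> p = q \<cdot> m"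
    using coequalizer_factor[OF coeq] by metis
  then have v: "v \<in> Hom C B Q" by simp
  have "is_mono C v"
  proof (rule is_monoI[OF v])
    fix Z b b'
    assume b: "b \<in> Hom C Z B" and b': "b' \<in> Hom C Z B" and bb': "v \<cdot> b = v \<cdot> b'"
    obtain Z1 z1 s where 1: "z1 \<in> Hom C Z1 Z" "is_regular_epi C z1" "s \<in> Hom C Z1 S" "p \<cdot> s = b \<cdot> z1"
      using regular_epi_lift[OF p(2,1) b] .
    obtain Z2 z2 s' where 2: "z2 \<in> Hom C Z2 Z1" "is_regular_epi C z2" "s' \<in> Hom C Z2 S"
      "p \<cdot> s' = (b' \<cdot> z1) \<cdot> z2"
      using regular_epi_lift[OF p(2,1) comp_closed[OF 1(1) b']] .
    note [simp] = HomD[OF v] HomD[OF b] HomD[OF b'] HomD[OF 1(1)] HomD[OF 1(3)] HomD[OF 2(1)] HomD[OF 2(3)]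
    have ps: "p \<cdot> (s \<cdot> z2) = b \<cdot> (z1 \<cdot> z2)" using comp_reassoc[OF 1(4), of z2] by simp
    have "q \<cdot> (m \<cdot> (s \<cdot> z2)) = v \<cdot> (p \<cdot> (s \<cdot> z2))" using comp_reassoc[OF vp, of "s \<cdot> z2"] by simp
    also have "\<dots> = v \<cdot> (p \<cdot> s')"
      unfolding ps 2(4) using comp_reassoc[OF bb', of "z1 \<cdot> z2"] by simp
    also have "\<dots> = q \<cdot> (m \<cdot> s')" using comp_reassoc[OF vp, of s'] by simp
    finally have "q \<cdot> (m \<cdot> (s \<cdot> z2)) = q \<cdot> (m \<cdot> s')" .
    moreover have "m \<cdot> (s \<cdot> z2) \<in> Hom C Z2 A" "m \<cdot> s' \<in> Hom C Z2 A" by (simp_all add: Hom_iff)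
    ultimately obtain Z3 z3 t where 3: "z3 \<in> Hom C Z3 Z2" "is_regular_epi C z3"
      "t \<in> Hom C Z3 (coprod A K)" "c \<cdot> t = (m \<cdot> (s \<cdot> z2)) \<cdot> z3" "d \<cdot> t = (m \<cdot> s') \<cdot> z3"
      using cover by blast
    note [simp] = HomD[OF 3(1)] HomD[OF 3(3)]
    have sH: "s \<cdot> (z2 \<cdot> z3) \<in> Hom C Z3 S" by (simp add: Hom_iff)
    \<comment> \<open>An element \<open>t\<close> whose \<open>c\<close>-value lies in
      \<open>S\<close> comes from \<open>S + K\<close>. Its two legs then land in \<open>S\<close>,
      where \<open>p\<close> cannot distinguish them.\<close>
    have "m \<cdot> (s \<cdot> (z2 \<cdot> z3)) = \<lbrace>ident C A, m \<cdot> k1\<rbrace> \<cdot> t" using 3(4) by (simp add: c_def)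
    from mono_pullback_cotuple_through[OF m kH(1) 3(3) sH this]
    obtain w where w: "w \<in> Hom C Z3 (coprod S K)" "(m \<oplus> ident C K) \<cdot> w = t"
      "\<lbrace>ident C S, k1\<rbrace> \<cdot> w = s \<cdot> (z2 \<cdot> z3)" .
    note [simp] = HomD[OF w(1)]
    have "m \<cdot> (\<lbrace>ident C S, k2\<rbrace> \<cdot> w) = m \<cdot> (s' \<cdot> z3)"
      using 3(5) unfolding w(2)[symmetric] by (simp add: d_def coprod_map_def)
    then have s': "\<lbrace>ident C S, k2\<rbrace> \<cdot> w = s' \<cdot> z3"
      using is_monoD[OF m(2), of "\<lbrace>ident C S, k2\<rbrace> \<cdot> w" Z3 "s' \<cdot> z3"] by (simp add: Hom_iff)
    have "((b \<cdot> z1) \<cdot> z2) \<cdot> z3 = p \<cdot> (\<lbrace>ident C S, k1\<rbrace> \<cdot> w)"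
      unfolding w(3) using comp_reassoc[OF ps, of z3] by simp
    also have "\<dots> = p \<cdot> (\<lbrace>ident C S, k2\<rbrace> \<cdot> w)" using pk by simp
    also have "\<dots> = ((b' \<cdot> z1) \<cdot> z2) \<cdot> z3"
      unfolding s' using comp_reassoc[OF 2(4), of z3] by simp
    finally have "(b \<cdot> z1) \<cdot> z2 = (b' \<cdot> z1) \<cdot> z2"
      using regular_epi_cancel[OF 3(2), of "(b \<cdot> z1) \<cdot> z2" B "(b' \<cdot> z1) \<cdot> z2"] by (simp add: Hom_iff)
    then have "b \<cdot> z1 = b' \<cdot> z1"
      using regular_epi_cancel[OF 2(2), of "b \<cdot> z1" B "b' \<cdot> z1"] by (simp add: Hom_iff)
    then show "b = b'" using regular_epi_cancel[OF 1(2), of b B b'] by (simp add: Hom_iff)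
  qed
  then show thesis using that[OF q(1) v] vp by simp
qed

text \<open>The regular part of \<open>f\<close> is treated first. It leaves a monic leg
  \<open>v1\<close>, which is what amalgamation with the monic part requires.\<close>

lemma amalgamation:
  assumes m: "m \<in> Hom C S A" "is_mono C m" and f: "f \<in> Hom C S B"
  obtains Q u v where "u \<in> Hom C A Q" "v \<in> Hom C B Q" "u \<cdot> m = v \<cdot> f" "is_mono C v"
proof -
  obtain I e n where en: "e \<in> Hom C S I" "n \<in> Hom C I B" "is_regular_epi C e" "is_mono C n" "f = n \<cdot> e"
    using image_factorization[OF f] .
  obtain Q1 u1 v1 where 1: "u1 \<in> Hom C A Q1" "v1 \<in> Hom C I Q1" "u1 \<cdot> m = v1 \<cdot> e" "is_mono C v1"
    using mono_regular_epi_amalgamation[OF m en(1,3)] .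
  obtain Q u2 v where 2: "u2 \<in> Hom C Q1 Q" "v \<in> Hom C B Q" "u2 \<cdot> v1 = v \<cdot> n" "is_mono C v"
    using mono_amalgamation[OF 1(2,4) en(2,4)] .
  note [simp] = HomD[OF m(1)] HomD[OF en(1)] HomD[OF en(2)] HomD[OF 1(1)] HomD[OF 1(2)]
    HomD[OF 2(1)] HomD[OF 2(2)]
  have "u2 \<cdot> u1 \<cdot> m = v \<cdot> f"
    using 1(3) comp_reassoc[OF 2(3), of e] en(5) by simp
  then show thesis using that[OF comp_closed[OF 1(1) 2(1)] 2(2) _ 2(4)] by blast
qed


section \<open>Coreflexive corelations\<close>

text \<open>The common retraction makes \<open>d0\<close> and \<open>d1\<close> monic, so
  \<open>mono_pullback_cotuple\<close> applies to them. Joint epimorphy makes [d0, d1] a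
  coequalizer, and [g0, g1] descends along it once it respects its kernel pair.\<close>

lemma coreflexive_pair_pushout:
  assumes d: "d0 \<in> Hom C X R" "d1 \<in> Hom C X R"
    and r: "r \<in> Hom C R X" "r \<cdot> d0 = ident C X" "r \<cdot> d1 = ident C X"
    and epi: "\<And>Z g h. g \<in> Hom C R Z \<Longrightarrow> h \<in> Hom C R Z \<Longrightarrow> g \<cdot> d0 = h \<cdot> d0 \<Longrightarrow> g \<cdot> d1 = h \<cdot> d1 \<Longrightarrow> g = h"
    and pb: "is_pullback C d0 d1 m m"
    and g: "g0 \<in> Hom C X Z" "g1 \<in> Hom C X Z" "g0 \<cdot> m = g1 \<cdot> m"
  obtains k where "k \<in> Hom C R Z" "k \<cdot> d0 = g0" "k \<cdot> d1 = g1"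
proof -
  note [simp] = HomD[OF d(1)] HomD[OF d(2)] HomD[OF r(1)] HomD[OF g(1)] HomD[OF g(2)]
    is_pullbackD(3,6,7)[OF pb]
  have mono: "is_mono C d" if dH: "d \<in> Hom C X R" and rd: "r \<cdot> d = ident C X" for d
  proof (rule is_monoI[OF dH])
    fix Y x y
    assume x: "x \<in> Hom C Y X" and y: "y \<in> Hom C Y X" and eq: "d \<cdot> x = d \<cdot> y"
    note [simp] = HomD[OF dH] HomD[OF x] HomD[OF y]
    have "x = r \<cdot> (d \<cdot> x)" using comp_reassoc[OF rd, of x] by simp
    also have "\<dots> = r \<cdot> (d \<cdot> y)" unfolding eq ..
    also have "\<dots> = y" using comp_reassoc[OF rd, of y] by simp
    finally show "x = y" .
  qed
  let ?g = "\<lbrace>g0, g1\<rbrace>"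
  define e where "e = \<lbrace>d0, d1\<rbrace>"
  have eH: "e \<in> Hom C (coprod X X) R" by (simp add: e_def Hom_iff)
  have e_reg: "is_regular_epi C e"
  proof (rule epi_regular[OF eH])
    fix Y g h
    assume g: "g \<in> Hom C R Y" and h: "h \<in> Hom C R Y" and eq: "g \<cdot> e = h \<cdot> e"
    note [simp] = HomD[OF eH] HomD[OF g] HomD[OF h]
    have "(g \<cdot> e) \<cdot> inl X X = (h \<cdot> e) \<cdot> inl X X" "(g \<cdot> e) \<cdot> inr X X = (h \<cdot> e) \<cdot> inr X X"
      unfolding eq by simp_all
    then show "g = h" using epi[OF g h] by (simp add: e_def)
  qed
  \<comment> \<open>One half of the kernel pair: \<open>a\<close> and \<open>b\<close> come from a
    single element of \<open>X\<close> plus the domain of \<open>m\<close>, and on the second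
    summand \<open>h\<close> and \<open>h'\<close> agree.\<close>
  have half: "\<lbrace>h, h'\<rbrace> \<cdot> a = h \<cdot> b"
    if \<delta>: "\<delta> \<in> Hom C X R" "r \<cdot> \<delta> = ident C X" and pb': "is_pullback C \<delta> \<delta>' m m"
      and a: "a \<in> Hom C P (coprod X X)" and b: "b \<in> Hom C P X" and ab: "\<lbrace>\<delta>, \<delta>'\<rbrace> \<cdot> a = \<delta> \<cdot> b"
      and h: "h \<in> Hom C X Z" "h' \<in> Hom C X Z" "h \<cdot> m = h' \<cdot> m" for \<delta> \<delta>' a b P h h'
  proof -
    note [simp] = HomD[OF \<delta>(1)] HomD[OF a] HomD[OF b] HomD[OF h(1)] HomD[OF h(2)]
    have "dom C \<delta>' = X" using is_pullbackD(7)[OF pb'] by simp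
    then obtain w where w: "w \<in> Hom C P (coprod X (dom C m))" "(ident C X \<oplus> m) \<cdot> w = a"
      "\<lbrace>ident C X, m\<rbrace> \<cdot> w = b"
      using mono_pullback_cotuple[OF \<delta>(1) mono[OF \<delta>] pb', of a P b] a b ab by auto
    note [simp] = HomD[OF w(1)]
    show ?thesis unfolding w(2,3)[symmetric] by (simp add: coprod_map_def h(3))
  qed
  have kernel: "?g \<cdot> x = ?g \<cdot> y"
    if x: "x \<in> Hom C Y (coprod X X)" and y: "y \<in> Hom C Y (coprod X X)" and xy: "e \<cdot> x = e \<cdot> y" for Y x y
  proof -
    note [simp] = HomD[OF x] HomD[OF y]
    obtain a0 b0 where pb0: "is_pullback C e d0 a0 b0" using pullback_exists[OF eH d(1)] .
    obtain a1 b1 where pb1: "is_pullback C e d1 a1 b1" using pullback_exists[OF eH d(2)] .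
    have abH: "a0 \<in> Hom C (dom C a0) (coprod X X)" "b0 \<in> Hom C (dom C a0) X"
      "a1 \<in> Hom C (dom C a1) (coprod X X)" "b1 \<in> Hom C (dom C a1) X"
      using is_pullbackD[OF pb0] is_pullbackD[OF pb1] HomD[OF eH] by (simp_all add: Hom_iff)
    note [simp] = HomD(1,3-5)[OF abH(1)] HomD[OF abH(2)] HomD(1,3-5)[OF abH(3)] HomD[OF abH(4)]
    have ga0: "?g \<cdot> a0 = g0 \<cdot> b0"
      using half[OF d(1) r(2) pb abH(1,2) _ g] is_pullbackD(9)[OF pb0] by (simp add: e_def)
    \<comment> \<open>The half for \<open>d1\<close> is the same statement with both the legs and
      the summands of \<open>X + X\<close> exchanged.\<close>
    have swap: "\<lbrace>inr X X, inl X X\<rbrace> \<cdot> a1 \<in> Hom C (dom C a1) (coprod X X)" by (simp add: Hom_iff)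
    have "\<lbrace>d1, d0\<rbrace> \<cdot> (\<lbrace>inr X X, inl X X\<rbrace> \<cdot> a1) = d1 \<cdot> b1"
      using is_pullbackD(9)[OF pb1] by (simp add: e_def)
    from half[OF d(2) r(3) pullback_sym[OF pb] swap abH(4) this g(2,1) g(3)[symmetric]]
    have ga1: "?g \<cdot> a1 = g1 \<cdot> b1" by simp
    obtain Y' z w where z: "z \<in> Hom C Y' Y" "is_regular_epi C z"
      and w: "w \<in> Hom C Y' (coprod (dom C a0) (dom C a1))" "\<lbrace>a0, a1\<rbrace> \<cdot> w = y \<cdot> z" "(b0 \<oplus> b1) \<cdot> w = x \<cdot> z"
      by (rule regular_epi_pullback_coprod_cover[OF eH e_reg pb0 pb1, of x Y y])
        (use x y xy in \<open>simp_all add: e_def\<close>)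
    note [simp] = HomD[OF z(1)] HomD[OF w(1)]
    have "(?g \<cdot> y) \<cdot> z = ?g \<cdot> (\<lbrace>a0, a1\<rbrace> \<cdot> w)" using w(2) by simp
    also have "\<dots> = \<lbrace>g0 \<cdot> b0, g1 \<cdot> b1\<rbrace> \<cdot> w" by (simp add: ga0 ga1)
    also have "\<dots> = ?g \<cdot> ((b0 \<oplus> b1) \<cdot> w)" by (simp add: coprod_map_def)
    also have "\<dots> = (?g \<cdot> x) \<cdot> z" unfolding w(3) by simp
    finally show ?thesis using regular_epi_cancel[OF z(2), of "?g \<cdot> y" Z "?g \<cdot> x"] by (simp add: Hom_iff)
  qed
  obtain u v where uv: "is_coequalizer C u v e" using e_reg unfolding is_regular_epi_def by blast
  have uvH: "u \<in> Hom C (dom C u) (coprod X X)" "v \<in> Hom C (dom C u) (coprod X X)"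
    using is_coequalizerD[OF uv] HomD[OF eH] by (simp_all add: Hom_iff)
  have "?g \<in> Hom C (cod C u) Z" using HomD(3)[OF uvH(1)] by (simp add: Hom_iff)
  from coequalizer_factor[OF uv this kernel[OF uvH is_coequalizerD(7)[OF uv]]]
  obtain k where k: "k \<in> Hom C (cod C e) Z" "k \<cdot> e = ?g" .
  have kH: "k \<in> Hom C R Z" using k(1) HomD[OF eH] by simp
  note [simp] = HomD[OF kH] HomD[OF eH]
  have "(k \<cdot> e) \<cdot> inl X X = g0" "(k \<cdot> e) \<cdot> inr X X = g1" unfolding k(2) by simp_all
  then show thesis using that[OF kH] by (simp add: e_def)
qed

text \<open>Applying \<open>r\<close> to the commuting square shows that its two projections
  coincide, so this pullback is an equalizer.\<close>

lemma coreflexive_pair_pullback: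
  assumes d: "d0 \<in> Hom C X R" "d1 \<in> Hom C X R"
    and r: "r \<in> Hom C R X" "r \<cdot> d0 = ident C X" "r \<cdot> d1 = ident C X"
  obtains m where "is_pullback C d0 d1 m m"
proof -
  obtain a b where pb: "is_pullback C d0 d1 a b" using pullback_exists[OF d] .
  note [simp] = HomD[OF d(1)] HomD[OF d(2)] HomD[OF r(1)] is_pullbackD(3-7)[OF pb]
  have "a = b"
    using comp_reassoc[OF r(2), of a] comp_reassoc[OF r(3), of b] is_pullbackD(9)[OF pb] by simp
  then show thesis using that pb by simp
qed

end


section \<open>The opposite category\<close>

lemma op_cat_simps [simp]:
  "Obj (op_cat C) = Obj C" "Arr (op_cat C) = Arr C" "dom (op_cat C) = cod C" "cod (op_cat C) = dom C"
  "ident (op_cat C) = ident C" "g \<cdot>\<^bsub>op_cat C\<^esub> f = f \<cdot>\<^bsub>C\<^esub> g"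
  by (simp_all add: op_cat_def)

context exact_P_category
begin

interpretation op: category "op_cat C"
  by (rule category_op_cat) (rule category_axioms)

lemma coreflexive_pair_equalizer:
  assumes d: "d0 \<in> Hom C X R" "d1 \<in> Hom C X R"
    and r: "r \<in> Hom C R X" "r \<cdot> d0 = ident C X" "r \<cdot> d1 = ident C X"
  shows "\<exists>m. is_coequalizer (op_cat C) d0 d1 m"
proof -
  obtain m where pb: "is_pullback C d0 d1 m m" using coreflexive_pair_pullback[OF assms] .
  note [simp] = HomD[OF d(1)] HomD[OF d(2)] is_pullbackD(3,6,7)[OF pb]
  have "is_coequalizer (op_cat C) d0 d1 m"
  proof (rule op.is_coequalizerI[where K = R and X = X and Q = "dom C m"], unfold Hom_op_cat op_cat_simps)
    show "d0 \<cdot> m = d1 \<cdot> m" using is_pullbackD(9)[OF pb] .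
    fix Z h
    assume "h \<in> Hom C Z X" "d0 \<cdot> h = d1 \<cdot> h"
    then show "\<exists>k \<in> Hom C Z (dom C m). m \<cdot> k = h"
      using pullback_lift[OF pb, of h Z h] by auto
  next
    fix Z h k
    assume "h \<in> Hom C Z (dom C m)" "k \<in> Hom C Z (dom C m)" "m \<cdot> h = m \<cdot> k"
    then show "h = k" using pullback_joint_mono[OF pb] by blast
  qed (use d in \<open>simp_all add: Hom_iff\<close>)
  then show ?thesis ..
qed

text \<open>With the next lemma, the regular epimorphisms of the opposite category are exactly the
  monomorphisms.\<close>

lemma mono_regular_op:
  assumes m: "m \<in> Hom C S A" "is_mono C m"
  shows "is_regular_epi (op_cat C) m"
proof -
  obtain Q u v where uv: "u \<in> Hom C A Q" "v \<in> Hom C A Q" "u \<cdot> m = v \<cdot> m"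
    and factor: "\<And>Z x. x \<in> Hom C Z A \<Longrightarrow> u \<cdot> x = v \<cdot> x \<Longrightarrow> \<exists>k \<in> Hom C Z S. m \<cdot> k = x"
    by (rule mono_is_equalizer[OF m]) (rule that)
  have "is_coequalizer (op_cat C) u v m"
    by (rule op.is_coequalizerI[where K = Q and X = A and Q = S], unfold Hom_op_cat op_cat_simps)
      (use uv m factor is_monoD[OF m(2)] HomD(2)[OF m(1)] in auto)
  then show ?thesis unfolding is_regular_epi_def by blast
qed

lemma regular_epi_op_mono:
  assumes "is_regular_epi (op_cat C) m"
  shows "is_mono C m"
proof -
  have m: "m \<in> Arr C" using op.regular_epi_Arr[OF assms] by simp
  show ?thesis
  proof (rule is_monoI[of m "dom C m" "cod C m"])
    show "m \<in> Hom C (dom C m) (cod C m)" using m by (simp add: Hom_iff)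
    fix x g h
    assume "g \<in> Hom C x (dom C m)" "h \<in> Hom C x (dom C m)" "m \<cdot> g = m \<cdot> h"
    then show "g = h" using op.regular_epi_cancel[OF assms, of g x h] by (simp add: Hom_op_cat)
  qed
qed

text \<open>In the original category this is a cokernel pair, and its codiagonal is a common
  retraction of the two legs.\<close>

lemma kernel_pair_op_coequalizer:
  assumes "is_kernel_pair (op_cat C) f u v"
  shows "\<exists>q. is_coequalizer (op_cat C) u v q"
proof -
  have pb: "is_pullback (op_cat C) f f u v" using assms by (simp add: is_kernel_pair_def)
  have uv: "u \<in> Hom C (cod C f) (cod C u)" "v \<in> Hom C (cod C f) (cod C u)" "f \<in> Arr C"
    using op.is_pullbackD[OF pb] by (simp_all add: Hom_iff)
  have i: "ident C (cod C f) \<in> Hom (op_cat C) (cod C f) (dom (op_cat C) f)"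
    using uv(3) by (simp add: Hom_op_cat Hom_iff)
  obtain r where "r \<in> Hom (op_cat C) (cod C f) (dom (op_cat C) u)"
    "u \<cdot>\<^bsub>op_cat C\<^esub> r = ident C (cod C f)" "v \<cdot>\<^bsub>op_cat C\<^esub> r = ident C (cod C f)"
    using op.pullback_lift[OF pb i i refl] .
  then have r: "r \<in> Hom C (cod C u) (cod C f)" "r \<cdot> u = ident C (cod C f)" "r \<cdot> v = ident C (cod C f)"
    by (simp_all add: Hom_op_cat)
  show ?thesis using coreflexive_pair_equalizer[OF uv(1,2) r] .
qed

text \<open>The monic leg \<open>v\<close> of an amalgamation factors through the pushout leg
  \<open>q\<close>, which is therefore monic.\<close>

lemma regular_epi_op_pullback:
  assumes pb: "is_pullback (op_cat C) f g p q" and "is_regular_epi (op_cat C) f"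
  shows "is_regular_epi (op_cat C) q"
proof -
  have f: "f \<in> Hom C (dom C f) (cod C f)" and g: "g \<in> Hom C (dom C f) (cod C g)"
    and p: "p \<in> Hom C (cod C f) (cod C p)" and q: "q \<in> Hom C (cod C g) (cod C p)"
    using op.is_pullbackD[OF pb] by (simp_all add: Hom_iff)
  obtain Q u v where uv: "u \<in> Hom C (cod C f) Q" "v \<in> Hom C (cod C g) Q" "u \<cdot> f = v \<cdot> g" "is_mono C v"
    using amalgamation[OF f regular_epi_op_mono[OF assms(2)] g] .
  have "u \<in> Hom (op_cat C) Q (dom (op_cat C) f)" "v \<in> Hom (op_cat C) Q (dom (op_cat C) g)"
    "f \<cdot>\<^bsub>op_cat C\<^esub> u = g \<cdot>\<^bsub>op_cat C\<^esub> v"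
    using uv by (simp_all add: Hom_op_cat)
  from op.pullback_lift[OF pb this] obtain h where h: "h \<in> Hom C (cod C p) Q" "h \<cdot> q = v"
    by (auto simp: Hom_op_cat)
  have "is_mono C q"
  proof (rule is_monoI[OF q])
    fix Z x y
    assume x: "x \<in> Hom C Z (cod C g)" and y: "y \<in> Hom C Z (cod C g)" and eq: "q \<cdot> x = q \<cdot> y"
    have "v \<cdot> x = v \<cdot> y"
      using comp_assoc[OF x q h(1)] comp_assoc[OF y q h(1)] eq h(2) by simp
    then show "x = y" using is_monoD[OF uv(4)] x y HomD(2)[OF uv(2)] by simp
  qed
  then show ?thesis using mono_regular_op[OF q] by blast
qed

text \<open>The effective witness is the equalizer \<open>m\<close> of the corelation. Reflexivity
  becomes the common retraction, and joint monicity becomes joint epimorphy.\<close>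

lemma equivalence_relation_op_effective:
  assumes "is_equivalence_relation (op_cat C) R X d0 d1"
  shows "\<exists>f. is_kernel_pair (op_cat C) f d0 d1"
proof -
  have d: "d0 \<in> Hom C X R" "d1 \<in> Hom C X R"
    and epi: "\<And>Z g h. g \<in> Hom C R Z \<Longrightarrow> h \<in> Hom C R Z \<Longrightarrow> g \<cdot> d0 = h \<cdot> d0 \<Longrightarrow> g \<cdot> d1 = h \<cdot> d1 \<Longrightarrow> g = h"
    and "\<exists>r \<in> Hom C R X. r \<cdot> d0 = ident C X \<and> r \<cdot> d1 = ident C X"
    using assms unfolding is_equivalence_relation_def Hom_op_cat op_cat_simps by blast+
  then obtain r where r: "r \<in> Hom C R X" "r \<cdot> d0 = ident C X" "r \<cdot> d1 = ident C X" by blast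
  obtain m where pb: "is_pullback C d0 d1 m m" using coreflexive_pair_pullback[OF d r] .
  have mH: "m \<in> Hom C (dom C m) X" using is_pullbackD[OF pb] HomD(2)[OF d(1)] by (simp add: Hom_iff)
  have "is_pullback (op_cat C) m m d0 d1"
  proof (rule op.is_pullbackI[where X = X and X' = X and Y = "dom C m" and P = R],
      unfold Hom_op_cat op_cat_simps)
    show "d0 \<cdot> m = d1 \<cdot> m" using is_pullbackD(9)[OF pb] .
    fix Z u v
    assume uv: "u \<in> Hom C X Z" "v \<in> Hom C X Z" "u \<cdot> m = v \<cdot> m"
    show "\<exists>h \<in> Hom C R Z. h \<cdot> d0 = u \<and> h \<cdot> d1 = v"
      by (rule coreflexive_pair_pushout[OF d r _ pb uv]) (erule (3) epi, blast)
  qed (use d mH epi in blast)+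
  then show ?thesis unfolding is_kernel_pair_def by blast
qed

lemma coexact:
  assumes "finitely_cocomplete C"
  shows "coexact_category C"
  unfolding coexact_category_def exact_category_def regular_category_def
  using assms op.category_axioms kernel_pair_op_coequalizer regular_epi_op_pullback
    equivalence_relation_op_effective
  unfolding finitely_cocomplete_def by blast

end

theorem theorem4p11:
  fixes C :: "('o, 'a) cat"
  assumes "exact_category C"
    and "condition_P C"
    and "finitely_cocomplete C"
  shows "coexact_category C"
proof -
  have "regular_category C" using assms(1) by (simp add: exact_category_def)
  then interpret category C by (simp add: regular_category_def)
  interpret exact_P_category C
    by unfold_locales
      (use assms in \<open>auto simp: exact_category_def regular_category_def condition_P_def\<close>)
  show ?thesis by (rule coexact) fact
qed

end
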